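(* Let $(G,T)$ be a Steiner graph. Then $(G,T)$ is facet inducing if and only if it is constructable from irreducible facet inducing Steiner graphs (each of which then has at most $|T|$ terminals). Likewise for weighted Steiner graphs: a Steiner graph $(G,T)$ together with a weight vector $c$ is a facet inducing weighted Steiner graph if and only if it is constructable from irreducible facet inducing weighted Steiner graphs (each of which then has at most $|T|$ terminals).
   Context: Graphs are finite and have no loops or multiple edges. A Steiner graph $(G,T)$ consists of a connected graph $G$ with node set $V(G)$ and edge set $E(G)$ and a set $T\subseteq V(G)$ of terminals with $|T|\ge 2$. For $S\subseteq V(G)$, $\delta(S)=\delta_G(S)$ is the set of edges with exactly one endnode in $S$. The cut $\delta(S)$ is a $T$-Steiner cut if $T\cap S\neq\varnothing$ and $T\setminus S\neq\varnothing$. The $T$-Steiner cut dominant is $\mathrm{CUT}_+(G,T)=\mathrm{conv}\{\chi(\delta(S)) : \delta(S)\text{ a }T\text{-Steiner cut}\}+\mathbb{R}_{\ge 0}^{E(G)}$, where $\chi(\cdot)$ denotes the $0/1$ incidence vector in $\mathbb{R}^{E(G)}$. For $c\in\mathbb{R}^{E(G)}$ and $F\subseteq E(G)$, $c(F)=\sum_{e\in F}c_e$. For a nonnegative vector $c$, $\gamma_c(G,T)$ is the minimum of $c(\delta(S))$ over all $T$-Steiner cuts $\delta(S)$. A vector is in minimum integer form if its components are nonnegative integers with greatest common divisor one; the minimum integer form of a nonnegative rational nonzero vector is its unique positive scalar multiple in minimum integer form. A vector $c$ provides facet weights for $(G,T)$ if $c$ is in minimum integer form, $c_e>0$ for all $e\in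 E(G)$, $\gamma_c(G,T)>0$, and $cx\ge\gamma_c(G,T)$ defines a facet of $\mathrm{CUT}_+(G,T)$; $(G,T)$ is facet inducing if it has facet weights. A weighted Steiner graph $((G,T),c)$, with $c$ a vector of edge weights in minimum integer form, is facet inducing if $c$ provides facet weights for $(G,T)$. A facet inducing Steiner graph $(G,T)$ (weighted or not) is irreducible if $G$ has no cut node (a node $w$ such that $G\setminus w$, the graph with $w$ and its incident edges removed, is disconnected) and no node in $V(G)\setminus T$ has degree two. Subdivision: $(G,T)$ is obtained by a subdivision from $(G',T')$ if $T=T'$ and $G$ arises from $G'$ by replacing an edge $uv$ by the two edges $uw$ and $vw$, where $w\notin V(G')$ is a new (non-terminal) node. In the weighted case, weights $c'$ on $G'$ are replaced by $c$ with $c(uw)=c(vw)=c'(uv)$ and $c(e)=c'(e)$ for all other edges. Gluing: if $V(G_1)\cap V(G_2)=\{w\}$ and $w\in T_1\cap T_2$, then gluing $(G_1,T_1)$ and $(G_2,T_2)$ at $w$ yields a Steiner graph $(G,T)$ with $V(G)=V(G_1)\cup V(G_2)$, $E(G)=E(G_1)\cup E(G_2)$, and $T=T_1\cup T_2$ or $T=(T_1\cup T_2)\setminus\{w\}$ (either choice is allowed). In the weighted case, with $c_1,c_2$ in minimum integer form, the glued weight vector is the minimum integer form of $(\gamma_{c_2}(G_2,T_2)\cdot c_1,\ \gamma_{c_1}(G_1,T_1)\cdot c_2)$. A (weighted) Steiner graph $(G,T)$ is constructable from a family $\mathcal{F}$ of (weighted) Steiner graphs if there is a sequence $(G_0,T_0),\dots,(G_r,T_r)=(G,T)$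 with $(G_0,T_0)\in\mathcal{F}$ such that for each $i\in\{1,\dots,r\}$ the (weighted) Steiner graph $(G_i,T_i)$ is obtained as a subdivision of $(G_{i-1},T_{i-1})$ or by gluing $(G_{i-1},T_{i-1})$ with some member of $\mathcal{F}$. Here $\mathcal{F}$ is the family of all irreducible facet inducing (weighted) Steiner graphs. *)

theory Defs
  imports "HOL-Analysis.Analysis"
begin

text \<open>
  Graphs are finite and simple: edges are two-element sets of nodes, and nodes come from a finite
  type. This loses no generality, since all Steiner graphs that occur in a construction
  of \<open>(G, T)\<close> by subdivisions and gluings have their nodes in \<open>V(G)\<close>.
\<close>

record 'a steiner_graph =
  nodes :: "'a set"
  edges :: "'a set set"
  terminals :: "'a set"

definition connected_graph :: "'a set \<Rightarrow> 'a set set \<Rightarrow> bool" where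
  "connected_graph V E \<longleftrightarrow>
     V \<noteq> {} \<and> (\<forall>u\<in>V. \<forall>v\<in>V. (u, v) \<in> {(x, y). {x, y} \<in> E}\<^sup>*)"

definition is_steiner_graph :: "'a::finite steiner_graph \<Rightarrow> bool" where
  "is_steiner_graph G \<longleftrightarrow>
     edges G \<subseteq> {{u, v} | u v. u \<in> nodes G \<and> v \<in> nodes G \<and> u \<noteq> v} \<and>
     connected_graph (nodes G) (edges G) \<and>
     terminals G \<subseteq> nodes G \<and> card (terminals G) \<ge> 2"

definition cut :: "'a steiner_graph \<Rightarrow> 'a set \<Rightarrow> 'a set set" where
  "cut G S = {e \<in> edges G. card (e \<inter> S) = 1}"

definition steiner_cuts :: "'a steiner_graph \<Rightarrow> 'a set set set" where
  "steiner_cuts G =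
     {cut G S | S. S \<subseteq> nodes G \<and> terminals G \<inter> S \<noteq> {} \<and> terminals G - S \<noteq> {}}"

text \<open>
  The space of real vectors indexed by an edge set \<open>E\<close> is the coordinate subspace of vectors that
  vanish outside \<open>E\<close>. Convexity, inner product and affine dimension are inherited from the
  ambient Euclidean space.
\<close>

type_synonym 'a edge_vector = "real ^ ('a set)"

definition edge_space :: "'a set set \<Rightarrow> ('a::finite) edge_vector set" where
  "edge_space E = {x. \<forall>e. e \<notin> E \<longrightarrow> x $ e = 0}"

definition incidence :: "'a set set \<Rightarrow> ('a::finite) edge_vector" where
  "incidence F = (\<chi> e. if e \<in> F then 1 else 0)"

definition cut_dominant :: "'a::finite steiner_graph \<Rightarrow> 'a edge_vector set" where
  "cut_dominant G =
     {x + y | x y. x \<in> convex hull (incidence ` steiner_cuts G) \<and>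
                   y \<in> edge_space (edges G) \<and> (\<forall>e. y $ e \<ge> 0)}"

definition weight :: "('a::finite) edge_vector \<Rightarrow> 'a set set \<Rightarrow> real" where
  "weight c F = (\<Sum>e\<in>F. c $ e)"

definition min_cut_weight :: "('a::finite) edge_vector \<Rightarrow> 'a steiner_graph \<Rightarrow> real" where
  "min_cut_weight c G = Min (weight c ` steiner_cuts G)"

definition min_integer_form :: "'a set set \<Rightarrow> ('a::finite) edge_vector \<Rightarrow> bool" where
  "min_integer_form E c \<longleftrightarrow>
     c \<in> edge_space E \<and>
     (\<exists>k :: 'a set \<Rightarrow> nat. (\<forall>e\<in>E. c $ e = real (k e)) \<and> Gcd (k ` E) = 1)"

definition min_integer_form_of ::
    "'a set set \<Rightarrow> ('a::finite) edge_vector \<Rightarrow> 'a edge_vector \<Rightarrow> bool" where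
  "min_integer_form_of E x c \<longleftrightarrow> min_integer_form E c \<and> (\<exists>r>0. c = r *\<^sub>R x)"

definition defines_facet ::
    "('a::finite) edge_vector \<Rightarrow> real \<Rightarrow> 'a edge_vector set \<Rightarrow> bool" where
  "defines_facet c b P \<longleftrightarrow> (\<forall>x\<in>P. c \<bullet> x \<ge> b) \<and> {x \<in> P. c \<bullet> x = b} facet_of P"

definition provides_facet_weights :: "('a::finite) edge_vector \<Rightarrow> 'a steiner_graph \<Rightarrow> bool" where
  "provides_facet_weights c G \<longleftrightarrow>
     min_integer_form (edges G) c \<and> (\<forall>e\<in>edges G. c $ e > 0) \<and>
     min_cut_weight c G > 0 \<and> defines_facet c (min_cut_weight c G) (cut_dominant G)"

definition facet_inducing :: "'a::finite steiner_graph \<Rightarrow> bool" where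
  "facet_inducing G \<longleftrightarrow> (\<exists>c. provides_facet_weights c G)"

type_synonym 'a weighted_steiner_graph = "'a steiner_graph \<times> 'a edge_vector"

definition facet_inducing_weighted :: "('a::finite) weighted_steiner_graph \<Rightarrow> bool" where
  "facet_inducing_weighted = (\<lambda>(G, c). provides_facet_weights c G)"

definition is_cut_node :: "'a steiner_graph \<Rightarrow> 'a \<Rightarrow> bool" where
  "is_cut_node G w \<longleftrightarrow>
     w \<in> nodes G \<and> \<not> connected_graph (nodes G - {w}) {e \<in> edges G. w \<notin> e}"

definition degree :: "'a steiner_graph \<Rightarrow> 'a \<Rightarrow> nat" where
  "degree G v = card {e \<in> edges G. v \<in> e}"

definition irreducible_graph :: "'a steiner_graph \<Rightarrow> bool" where
  "irreducible_graph G \<longleftrightarrow>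
     (\<nexists>w. is_cut_node G w) \<and> (\<forall>v \<in> nodes G - terminals G. degree G v \<noteq> 2)"

definition irreducible_facet_inducing :: "('a::finite) steiner_graph set" where
  "irreducible_facet_inducing =
     {G. is_steiner_graph G \<and> facet_inducing G \<and> irreducible_graph G}"

definition irreducible_facet_inducing_weighted :: "('a::finite) weighted_steiner_graph set" where
  "irreducible_facet_inducing_weighted =
     {(G, c). is_steiner_graph G \<and> facet_inducing_weighted (G, c) \<and> irreducible_graph G}"

definition subdivides_edge ::
    "'a steiner_graph \<Rightarrow> 'a \<Rightarrow> 'a \<Rightarrow> 'a \<Rightarrow> 'a steiner_graph \<Rightarrow> bool" where
  "subdivides_edge G' u v w G \<longleftrightarrow>
     {u, v} \<in> edges G' \<and> w \<notin> nodes G' \<and>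
     nodes G = insert w (nodes G') \<and>
     edges G = (edges G' - {{u, v}}) \<union> {{u, w}, {v, w}} \<and>
     terminals G = terminals G'"

definition subdivision :: "'a steiner_graph \<Rightarrow> 'a steiner_graph \<Rightarrow> bool" where
  "subdivision G' G \<longleftrightarrow> (\<exists>u v w. subdivides_edge G' u v w G)"

definition subdivision_weighted ::
    "('a::finite) weighted_steiner_graph \<Rightarrow> 'a weighted_steiner_graph \<Rightarrow> bool" where
  "subdivision_weighted = (\<lambda>(G', c') (G, c). \<exists>u v w.
     subdivides_edge G' u v w G \<and>
     c \<in> edge_space (edges G) \<and>
     c $ {u, w} = c' $ {u, v} \<and> c $ {v, w} = c' $ {u, v} \<and>
     (\<forall>e \<in> edges G' - {{u, v}}. c $ e = c' $ e))"

definition gluing ::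
    "'a steiner_graph \<Rightarrow> 'a steiner_graph \<Rightarrow> 'a steiner_graph \<Rightarrow> bool" where
  "gluing G1 G2 G \<longleftrightarrow> (\<exists>w.
     nodes G1 \<inter> nodes G2 = {w} \<and> w \<in> terminals G1 \<inter> terminals G2 \<and>
     nodes G = nodes G1 \<union> nodes G2 \<and>
     edges G = edges G1 \<union> edges G2 \<and>
     (terminals G = terminals G1 \<union> terminals G2 \<or>
      terminals G = (terminals G1 \<union> terminals G2) - {w}))"

text \<open>
  Below, the edge sets of \<open>G1\<close> and \<open>G2\<close> are disjoint, and \<open>c1\<close>, \<open>c2\<close> vanish outside them, so the
  sum is the concatenation of the two scaled weight vectors.
\<close>

definition gluing_weighted ::
    "('a::finite) weighted_steiner_graph \<Rightarrow> 'a weighted_steiner_graph \<Rightarrow>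
     'a weighted_steiner_graph \<Rightarrow> bool" where
  "gluing_weighted = (\<lambda>(G1, c1) (G2, c2) (G, c).
     gluing G1 G2 G \<and>
     min_integer_form_of (edges G)
       (min_cut_weight c2 G2 *\<^sub>R c1 + min_cut_weight c1 G1 *\<^sub>R c2) c)"

text \<open>
  \<open>constructed_from sub glue F Hs G\<close>: there is a construction sequence ending in \<open>G\<close> in which the
  members of \<open>F\<close> used are, in this order, those in the list \<open>Hs\<close> (the starting member first, then
  the members glued on).
\<close>

inductive constructed_from ::
    "('g \<Rightarrow> 'g \<Rightarrow> bool) \<Rightarrow> ('g \<Rightarrow> 'g \<Rightarrow> 'g \<Rightarrow> bool) \<Rightarrow> 'g set \<Rightarrow> 'g list \<Rightarrow> 'g \<Rightarrow> bool"
  for sub :: "'g \<Rightarrow> 'g \<Rightarrow> bool" and glue :: "'g \<Rightarrow> 'g \<Rightarrow> 'g \<Rightarrow> bool" and F :: "'g set"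
where
  start: "H \<in> F \<Longrightarrow> constructed_from sub glue F [H] H"
| subdivide: "constructed_from sub glue F Hs G' \<Longrightarrow> sub G' G \<Longrightarrow> constructed_from sub glue F Hs G"
| glue: "constructed_from sub glue F Hs G' \<Longrightarrow> H \<in> F \<Longrightarrow> glue G' H G \<Longrightarrow>
    constructed_from sub glue F (Hs @ [H]) G"

definition constructable :: "('a::finite) steiner_graph set \<Rightarrow> 'a steiner_graph \<Rightarrow> bool" where
  "constructable F G \<longleftrightarrow> (\<exists>Hs. constructed_from subdivision gluing F Hs G)"

definition constructable_weighted ::
    "('a::finite) weighted_steiner_graph set \<Rightarrow> 'a weighted_steiner_graph \<Rightarrow> bool" where
  "constructable_weighted F W \<longleftrightarrow>
     (\<exists>Hs. constructed_from subdivision_weighted gluing_weighted F Hs W)"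

end

(*
  Idea. For positive weights c with minimum Steiner cut weight g > 0, the inequality cx >= g defines
  a facet iff the incidence vectors of the tight (minimum weight) Steiner cuts span the edge space,
  that is, iff 0 is the only vector giving weight 0 to all tight cuts ("rigid" weights).  This
  criterion is invariant under scaling.  Under subdivision the tight cuts correspond, since a
  subdividing node never pays for separating itself from both neighbours.  Under gluing, the tight
  cuts of the two parts are tight in the result.  Conversely, a non-terminal of degree two in a rigid
  graph can be suppressed, and at a cut node each tight cut lies in one of the two sides.  Choosing
  the separation with the smallest side makes that side free of cut nodes, hence irreducible once all
  non-terminals of degree two are suppressed; induct on the number of nodes.
*)

theory Submission
  imports Defs
begin

section \<open>Cuts and connectivity\<close>

text \<open>Positivity of the weights is what makes the spanning criterion work: every point of the
  face is a convex combination of tight cuts with nothing added, and since g > 0 the affine hull of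
  the face misses the origin, so affine dimension |E| - 1 means linear dimension |E|. The criterion
  is used in its dual form, because a test vector on the edges is easily moved between graphs. A
  gluing step may attach only a member of the irreducible family, while the graph built so far is
  arbitrary. This asymmetry is why one side of a separation has to be irreducible. A tight cut
  cannot use edges on both sides of a cut node: it would pay at least g on one side and something
  positive on the other. Consequently both sides carry terminals and have the same minimum g, and
  this common minimum is why the scaling prescribed for a gluing reproduces the original
  weights.\<close>

lemma cut_subset: "cut G S \<subseteq> edges G"
  by (auto simp: cut_def)

lemma steiner_cuts_subset: "D \<in> steiner_cuts G \<Longrightarrow> D \<subseteq> edges G"
  by (auto simp: steiner_cuts_def cut_def)

section \<open>Weights of edge sets as linear functionals\<close>

lemma weight_inner:
  fixes c :: "('a::finite) edge_vector"
  shows "c \<bullet> incidence D = weight c D"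
proof -
  have "c \<bullet> incidence D = (\<Sum>e\<in>UNIV. if e \<in> D then c $ e else 0)"
    unfolding inner_vec_def incidence_def by (intro sum.cong) auto
  also have "\<dots> = weight c D"
    by (simp add: weight_def sum.If_cases)
  finally show ?thesis .
qed

lemma weight_scaleR: "weight (r *\<^sub>R c) D = r * weight c D"
  by (simp add: weight_def sum_distrib_left)

lemma weight_add: "weight (c + d) D = weight c D + weight d D"
  by (simp add: weight_def sum.distrib)

lemma weight_minus: "weight (c - d) D = weight c D - weight d D"
  by (simp add: weight_def sum_subtractf)

lemma weight_axis: "weight (axis e 1) D = (if e \<in> D then 1 else 0)"
  by (simp add: weight_def axis_def)

lemma edge_space_subspace: "subspace (edge_space E)"
  by (auto simp: subspace_def edge_space_def)

lemma axis_in_edge_space: "e \<in> E \<Longrightarrow> axis e r \<in> edge_space E"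
  by (auto simp: edge_space_def axis_def)

lemma incidence_in_edge_space: "D \<subseteq> E \<Longrightarrow> incidence D \<in> edge_space E"
  by (auto simp: edge_space_def incidence_def)

lemma edge_of_graph:
  assumes "is_steiner_graph G" "e \<in> edges G"
  obtains u v where "e = {u, v}" "u \<in> nodes G" "v \<in> nodes G" "u \<noteq> v"
  using assms unfolding is_steiner_graph_def by blast

abbreviation simple_edges :: "'a set \<Rightarrow> 'a set set" where
  "simple_edges V \<equiv> {{u, v} | u v. u \<in> V \<and> v \<in> V \<and> u \<noteq> v}"

lemma card_Int_pair_eq_1:
  "u \<noteq> v \<Longrightarrow> card ({u, v} \<inter> S) = 1 \<longleftrightarrow> (u \<in> S) \<noteq> (v \<in> S)"
  by (cases "u \<in> S"; cases "v \<in> S") auto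

lemma pair_in_cut:
  "u \<noteq> v \<Longrightarrow> {u, v} \<in> cut G S \<longleftrightarrow> {u, v} \<in> edges G \<and> (u \<in> S) \<noteq> (v \<in> S)"
  unfolding cut_def using card_Int_pair_eq_1[of u v S] by auto

lemma in_cut_iff:
  assumes "edges G \<subseteq> simple_edges V"
  shows "e \<in> cut G S \<longleftrightarrow> e \<in> edges G \<and> e \<inter> S \<noteq> {} \<and> e - S \<noteq> {}"
proof (cases "e \<in> edges G")
  case True
  then obtain u v where "e = {u, v}" "u \<noteq> v" using assms by blast
  then show ?thesis using True pair_in_cut[of u v G S] by auto
qed (auto simp: cut_def)

text \<open>No edge leaves the set of nodes reachable from a given node, so that set is everything
  once every proper nonempty set is crossed. Later connectivity proofs exhibit a crossing edge,
  which transfers between graphs more easily than a walk.\<close>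

lemma connected_graph_iff_cuts:
  assumes "E \<subseteq> simple_edges V"
  shows "connected_graph V E \<longleftrightarrow>
    V \<noteq> {} \<and> (\<forall>S\<subseteq>V. S \<noteq> {} \<longrightarrow> S \<noteq> V \<longrightarrow> (\<exists>e\<in>E. e \<inter> S \<noteq> {} \<and> e - S \<noteq> {}))"
    (is "_ \<longleftrightarrow> _ \<and> ?R")
proof -
  let ?r = "{(x, y). {x, y} \<in> E}"
  have "?R" if con: "connected_graph V E"
  proof (intro allI impI, rule ccontr)
    fix S assume S: "S \<subseteq> V" "S \<noteq> {}" "S \<noteq> V" and no: "\<not> (\<exists>e\<in>E. e \<inter> S \<noteq> {} \<and> e - S \<noteq> {})"
    then obtain u v where uv: "u \<in> S" "v \<in> V" "v \<notin> S" by blast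
    have "(u, v) \<in> ?r\<^sup>*" using con uv S unfolding connected_graph_def by blast
    then have "v \<in> S"
    proof (induction rule: rtrancl_induct)
      case (step y z)
      then have "{y, z} \<in> E" "y \<in> S" by auto
      moreover from this have "{y, z} - S = {}" using no by (metis disjoint_iff insertI1)
      ultimately show ?case by simp
    qed (rule uv)
    with uv show False by simp
  qed
  moreover have "connected_graph V E" if "V \<noteq> {}" and R: "?R"
    unfolding connected_graph_def
  proof (intro conjI ballI)
    fix u v assume uv: "u \<in> V" "v \<in> V"
    define S where "S = {x \<in> V. (u, x) \<in> ?r\<^sup>*}"
    have "S = V"
    proof (rule ccontr)
      assume "S \<noteq> V"
      moreover have "u \<in> S" using uv by (simp add: S_def)
      moreover have "S \<subseteq> V" by (auto simp: S_def)
      ultimately obtain e where e: "e \<in> E" "e \<inter> S \<noteq> {}" "e - S \<noteq> {}" using R by blast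
      then obtain x y where xy: "x \<in> S" "x \<in> e" "y \<in> e" "y \<notin> S" by blast
      moreover have "e = {x, y}" "y \<in> V" using e(1) assms xy by auto
      ultimately have "(x, y) \<in> ?r" using e by simp
      moreover have "(u, x) \<in> ?r\<^sup>*" using xy by (simp add: S_def)
      ultimately have "y \<in> S" using \<open>y \<in> V\<close> by (auto simp: S_def intro: rtrancl_into_rtrancl)
      with xy show False by simp
    qed
    with uv show "(u, v) \<in> ?r\<^sup>*" by (auto simp: S_def)
  qed (rule that)
  ultimately show ?thesis by (auto simp: connected_graph_def)
qed

lemma cut_complement:
  assumes "edges G \<subseteq> simple_edges (nodes G)"
  shows "cut G (nodes G - S) = cut G S"
proof -
  have "e \<in> cut G (nodes G - S) \<longleftrightarrow> e \<in> cut G S" for e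
    unfolding in_cut_iff[OF assms] using assms by auto
  then show ?thesis by blast
qed

context
  fixes G :: "'a::finite steiner_graph"
  assumes steiner: "is_steiner_graph G"
begin

lemma edges_simple: "edges G \<subseteq> simple_edges (nodes G)"
  and terminals_subset: "terminals G \<subseteq> nodes G"
  and terminals_card: "card (terminals G) \<ge> 2"
  and graph_connected: "connected_graph (nodes G) (edges G)"
  using steiner by (auto simp: is_steiner_graph_def)

lemma steiner_cutI:
  "S \<subseteq> nodes G \<Longrightarrow> terminals G \<inter> S \<noteq> {} \<Longrightarrow> terminals G - S \<noteq> {} \<Longrightarrow> cut G S \<in> steiner_cuts G"
  by (auto simp: steiner_cuts_def)

text \<open>Both shores of a Steiner cut meet the terminals and define the same edges, so the shore
  that misses \<open>w\<close> may be chosen. For a gluing or cut node \<open>w\<close>, such a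
  shore falls apart along the two pieces.\<close>

lemma steiner_cut_avoiding:
  assumes "D \<in> steiner_cuts G"
  obtains S where "S \<subseteq> nodes G" "w \<notin> S" "terminals G \<inter> S \<noteq> {}" "terminals G - S \<noteq> {}" "D = cut G S"
proof -
  obtain S where S: "S \<subseteq> nodes G" "terminals G \<inter> S \<noteq> {}" "terminals G - S \<noteq> {}" "D = cut G S"
    using assms by (auto simp: steiner_cuts_def)
  show thesis
  proof (cases "w \<in> S")
    case True
    have "terminals G \<inter> (nodes G - S) = terminals G - S"
      "terminals G - (nodes G - S) = terminals G \<inter> S" using terminals_subset by auto
    then show thesis
      using that[of "nodes G - S"] True S by (simp add: cut_complement[OF edges_simple])
  qed (use that S in blast)
qed

lemma steiner_cuts_nonempty: "steiner_cuts G \<noteq> {}"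
proof -
  obtain t where t: "t \<in> terminals G" using terminals_card by fastforce
  have "terminals G - {t} \<noteq> {}"
  proof
    assume "terminals G - {t} = {}"
    then have "terminals G = {t}" using t by auto
    then show False using terminals_card by simp
  qed
  then have "cut G {t} \<in> steiner_cuts G"
    using t terminals_subset by (intro steiner_cutI) auto
  then show ?thesis by blast
qed

lemma cut_nonempty:
  assumes "S \<subseteq> nodes G" "S \<noteq> {}" "S \<noteq> nodes G"
  shows "cut G S \<noteq> {}"
proof -
  obtain e where "e\<in>edges G" "e \<inter> S \<noteq> {}" "e - S \<noteq> {}"
    using graph_connected[unfolded connected_graph_iff_cuts[OF edges_simple]] assms by blast
  then have "e \<in> cut G S" by (simp add: in_cut_iff[OF edges_simple])
  then show ?thesis by blast
qed

lemma steiner_cut_nonempty: "D \<in> steiner_cuts G \<Longrightarrow> D \<noteq> {}"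
  using cut_nonempty terminals_subset by (auto simp: steiner_cuts_def)

lemma min_cut_weight_le: "D \<in> steiner_cuts G \<Longrightarrow> min_cut_weight c G \<le> weight c D"
  unfolding min_cut_weight_def by (intro Min_le) auto

lemma min_cut_weight_attained:
  obtains D where "D \<in> steiner_cuts G" "weight c D = min_cut_weight c G"
proof -
  have "min_cut_weight c G \<in> weight c ` steiner_cuts G"
    unfolding min_cut_weight_def using steiner_cuts_nonempty by (intro Min_in) auto
  then show thesis using that by auto
qed

lemma min_cut_weight_eqI:
  assumes "\<And>D. D \<in> steiner_cuts G \<Longrightarrow> weight c D \<ge> b" "D \<in> steiner_cuts G" "weight c D = b"
  shows "min_cut_weight c G = b"
  unfolding min_cut_weight_def using assms by (intro Min_eqI) auto

lemma min_cut_weight_scaleR: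
  assumes "r \<ge> 0"
  shows "min_cut_weight (r *\<^sub>R c) G = r * min_cut_weight c G"
proof -
  obtain D where "D \<in> steiner_cuts G" "weight c D = min_cut_weight c G"
    by (rule min_cut_weight_attained)
  with assms show ?thesis
    by (intro min_cut_weight_eqI[of _ _ D])
      (auto simp: weight_scaleR min_cut_weight_le mult_left_mono)
qed

lemma weight_pos:
  assumes "\<forall>e\<in>edges G. c $ e > 0" "D \<subseteq> edges G" "D \<noteq> {}"
  shows "weight c D > 0"
  unfolding weight_def using assms by (intro sum_pos) auto

lemma weight_nonneg:
  assumes "\<forall>e\<in>edges G. c $ e > 0" "D \<subseteq> edges G"
  shows "weight c D \<ge> 0"
  unfolding weight_def using assms by (intro sum_nonneg) (auto simp: less_imp_le subset_iff)

lemma min_cut_weight_pos: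
  assumes "\<forall>e\<in>edges G. c $ e > 0"
  shows "min_cut_weight c G > 0"
proof -
  obtain D where D: "D \<in> steiner_cuts G" "weight c D = min_cut_weight c G"
    by (rule min_cut_weight_attained)
  then show ?thesis using weight_pos[OF assms, of D] steiner_cuts_subset steiner_cut_nonempty by metis
qed

end

section \<open>Facets and rigid weights\<close>

definition tight_cuts :: "('a::finite) edge_vector \<Rightarrow> 'a steiner_graph \<Rightarrow> 'a set set set" where
  "tight_cuts c G = {D \<in> steiner_cuts G. weight c D = min_cut_weight c G}"

text \<open>The last condition says that no nonzero vector of the edge space is orthogonal to all
  tight cuts, that is, their incidence vectors span it. Integrality is left out so that the property
  is invariant under positive scaling.\<close>

definition rigid_weights :: "('a::finite) edge_vector \<Rightarrow> 'a steiner_graph \<Rightarrow> bool" where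
  "rigid_weights c G \<longleftrightarrow>
     c \<in> edge_space (edges G) \<and> (\<forall>e\<in>edges G. c $ e > 0) \<and>
     (\<forall>d\<in>edge_space (edges G). (\<forall>D\<in>tight_cuts c G. weight d D = 0) \<longrightarrow> d = 0)"

context
  fixes G :: "'a::finite steiner_graph" and c :: "'a edge_vector"
  assumes steiner: "is_steiner_graph G"
    and c_pos: "\<forall>e\<in>edges G. c $ e > 0"
begin

lemma cut_dominant_ge:
  assumes "x \<in> cut_dominant G"
  shows "c \<bullet> x \<ge> min_cut_weight c G"
proof -
  obtain p y where p: "p \<in> convex hull (incidence ` steiner_cuts G)" and
    y: "y \<in> edge_space (edges G)" "\<forall>e. y $ e \<ge> 0" and x: "x = p + y"
    using assms by (auto simp: cut_dominant_def)
  have "convex hull (incidence ` steiner_cuts G) \<subseteq> {x. c \<bullet> x \<ge> min_cut_weight c G}"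
    by (rule hull_minimal)
      (auto simp: weight_inner min_cut_weight_le[OF steiner] convex_halfspace_ge)
  then have "c \<bullet> p \<ge> min_cut_weight c G" using p by blast
  moreover have "c \<bullet> y \<ge> 0"
    unfolding inner_vec_def
  proof (rule sum_nonneg)
    fix e show "0 \<le> c $ e \<bullet> y $ e"
      using y c_pos by (cases "e \<in> edges G") (auto simp: edge_space_def less_imp_le)
  qed
  ultimately show ?thesis by (simp add: x inner_add_right)
qed

lemma hull_in_cut_dominant:
  assumes "p \<in> convex hull (incidence ` steiner_cuts G)"
  shows "p \<in> cut_dominant G"
  unfolding cut_dominant_def
proof (intro CollectI exI conjI)
  show "p = p + 0" "0 \<in> edge_space (edges G)" by (auto simp: edge_space_def)
qed (use assms in auto)

text \<open>In \<open>x = p + y\<close> the hull part already costs at least the minimum, so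
  \<open>y\<close> costs zero and vanishes because \<open>c\<close> is positive on every edge. The
  convex combination \<open>p\<close> then has average cost equal to the minimum, so only tight cuts
  get a positive coefficient.\<close>

lemma face_subset_span:
  assumes "x \<in> cut_dominant G" "c \<bullet> x = min_cut_weight c G"
  shows "x \<in> span (incidence ` tight_cuts c G)"
proof -
  let ?g = "min_cut_weight c G" and ?K = "incidence ` steiner_cuts G"
  obtain p y where p: "p \<in> convex hull ?K" and
    y: "y \<in> edge_space (edges G)" "\<forall>e. y $ e \<ge> 0" and x: "x = p + y"
    using assms by (auto simp: cut_dominant_def)
  have "p \<in> cut_dominant G" using p by (rule hull_in_cut_dominant)
  then have cp: "c \<bullet> p \<ge> ?g" by (rule cut_dominant_ge)
  have nn: "0 \<le> c $ e * y $ e" for e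
    using y c_pos by (cases "e \<in> edges G") (auto simp: edge_space_def less_imp_le)
  have cy: "c \<bullet> y = (\<Sum>e\<in>UNIV. c $ e * y $ e)" by (simp add: inner_vec_def)
  then have "c \<bullet> y \<ge> 0" using nn by (simp add: sum_nonneg)
  with cp assms have "c \<bullet> y = 0" and cpe: "c \<bullet> p = ?g" by (auto simp: x inner_add_right)
  then have "\<forall>e\<in>UNIV. c $ e * y $ e = 0" using cy nn by (simp add: sum_nonneg_eq_0_iff)
  then have "y $ e = 0" for e
    using y(1) c_pos by (cases "e \<in> edges G") (force simp: edge_space_def)+
  then have y0: "y = 0" by (simp add: vec_eq_iff)
  have "finite ?K" by simp
  then obtain u where u: "\<forall>k\<in>?K. 0 \<le> u k" "sum u ?K = 1" "(\<Sum>k\<in>?K. u k *\<^sub>R k) = p"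
    using p by (auto simp: convex_hull_finite)
  have ge: "c \<bullet> k \<ge> ?g" if "k \<in> ?K" for k
    using that min_cut_weight_le[OF steiner] by (auto simp: weight_inner)
  have "(\<Sum>k\<in>?K. u k * (c \<bullet> k - ?g)) = c \<bullet> (\<Sum>k\<in>?K. u k *\<^sub>R k) - (\<Sum>k\<in>?K. u k) * ?g"
    by (simp add: inner_sum_right algebra_simps sum_subtractf sum_distrib_left)
  also have "\<dots> = 0" using u cpe by simp
  finally have z: "\<forall>k\<in>?K. u k * (c \<bullet> k - ?g) = 0"
    using u ge by (subst (asm) sum_nonneg_eq_0_iff) auto
  have "u k *\<^sub>R k \<in> span (incidence ` tight_cuts c G)" if "k \<in> ?K" for k
  proof (cases "c \<bullet> k = ?g")
    case True
    then have "k \<in> incidence ` tight_cuts c G" using that by (auto simp: tight_cuts_def weight_inner)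
    then show ?thesis by (simp add: span_base span_scale)
  next
    case False
    then show ?thesis using z that by (auto simp: span_zero)
  qed
  then have "p \<in> span (incidence ` tight_cuts c G)"
    unfolding u(3)[symmetric] by (rule span_sum)
  then show ?thesis by (simp add: x y0)
qed

lemma tight_in_face:
  assumes "D \<in> tight_cuts c G"
  shows "incidence D \<in> {x \<in> cut_dominant G. c \<bullet> x = min_cut_weight c G}"
proof -
  have "incidence D \<in> convex hull (incidence ` steiner_cuts G)"
    using assms by (intro hull_inc) (auto simp: tight_cuts_def)
  then have "incidence D \<in> cut_dominant G" by (rule hull_in_cut_dominant)
  then show ?thesis using assms by (auto simp: tight_cuts_def weight_inner)
qed

lemma cut_dominant_add_axis:
  assumes "x \<in> cut_dominant G" "e \<in> edges G"
  shows "x + axis e 1 \<in> cut_dominant G"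
proof -
  obtain p y where p: "p \<in> convex hull (incidence ` steiner_cuts G)" and
    y: "y \<in> edge_space (edges G)" "\<forall>e. y $ e \<ge> 0" and x: "x = p + y"
    using assms by (auto simp: cut_dominant_def)
  have "y + axis e 1 \<in> edge_space (edges G)"
    using y axis_in_edge_space[OF assms(2)] edge_space_subspace by (blast intro: subspace_add)
  moreover have "\<forall>f. (y + axis e 1) $ f \<ge> 0" using y by (simp add: axis_def)
  moreover have "x + axis e 1 = p + (y + axis e 1)" by (simp add: x)
  ultimately show ?thesis unfolding cut_dominant_def using p by blast
qed

lemma cut_dominant_subset: "cut_dominant G \<subseteq> edge_space (edges G)"
proof -
  have "convex hull (incidence ` steiner_cuts G) \<subseteq> edge_space (edges G)"
    by (rule hull_minimal)
      (auto simp: subspace_imp_convex edge_space_subspace incidence_in_edge_space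
        dest: steiner_cuts_subset)
  then show ?thesis unfolding cut_dominant_def
    using edge_space_subspace by (fastforce intro: subspace_add)
qed

lemma convex_cut_dominant: "convex (cut_dominant G)"
proof -
  have "convex {y \<in> edge_space (edges G). \<forall>e. y $ e \<ge> 0}"
    by (auto simp: convex_def edge_space_def)
  then have "convex (\<Union>x\<in>convex hull (incidence ` steiner_cuts G).
      \<Union>y\<in>{y \<in> edge_space (edges G). \<forall>e. y $ e \<ge> 0}. {x + y})"
    by (intro convex_sums) auto
  also have "(\<Union>x\<in>convex hull (incidence ` steiner_cuts G).
      \<Union>y\<in>{y \<in> edge_space (edges G). \<forall>e. y $ e \<ge> 0}. {x + y}) = cut_dominant G"
    by (auto simp: cut_dominant_def)
  finally show ?thesis .
qed

text \<open>A test vector \<open>d\<close> that vanishes on tight cuts vanishes on the whole face.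
  One point \<open>q\<close> off the face completes it to the affine hull of the dominant, and a
  combination of \<open>c\<close> and \<open>d\<close> that agrees at \<open>q\<close> is then
  constant on the dominant. Since the dominant is unbounded in every edge direction, this functional
  is zero on the edge space, while its constant value is not.\<close>

lemma rigid_if_defines_facet:
  assumes facet: "defines_facet c (min_cut_weight c G) (cut_dominant G)"
    and d: "d \<in> edge_space (edges G)" and d0: "\<forall>D\<in>tight_cuts c G. weight d D = 0"
  shows "d = 0"
proof (rule ccontr)
  let ?g = "min_cut_weight c G" and ?P = "cut_dominant G"
  define F where "F = {x \<in> ?P. c \<bullet> x = ?g}"
  assume "d \<noteq> 0"
  then obtain e where e: "d $ e \<noteq> 0" by (auto simp: vec_eq_iff)
  then have eE: "e \<in> edges G" using d by (auto simp: edge_space_def)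
  have g: "?g > 0" by (rule min_cut_weight_pos[OF steiner c_pos])
  have "F facet_of ?P" using facet by (simp add: defines_facet_def F_def)
  then have "F \<noteq> {}" and dim: "aff_dim F = aff_dim ?P - 1" by (auto simp: facet_of_def)
  then obtain p where p: "p \<in> F" by blast
  have dF: "d \<bullet> x = 0" if "x \<in> F" for x
  proof -
    have "span (incidence ` tight_cuts c G) \<subseteq> {x. d \<bullet> x = 0}"
      by (rule span_minimal) (auto simp: weight_inner d0 subspace_hyperplane)
    then show ?thesis using face_subset_span that by (auto simp: F_def)
  qed
  \<comment> \<open>One step in direction \<open>e\<close>, where \<open>d\<close> is nonzero,
    leaves the hyperplane orthogonal to \<open>d\<close> that contains the face.\<close>
  define q where "q = p + axis e 1"
  have qP: "q \<in> ?P" using cut_dominant_add_axis[OF _ eE] p by (simp add: q_def F_def)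
  have dq: "d \<bullet> q = d $ e" by (simp add: q_def inner_add_right dF[OF p] inner_axis)
  have "affine hull F \<subseteq> {x. d \<bullet> x = 0}"
    by (rule hull_minimal) (auto simp: dF affine_hyperplane)
  then have "q \<notin> affine hull F" using dq e by auto
  then have "aff_dim (insert q F) = aff_dim ?P" using dim by (simp add: aff_dim_insert)
  moreover have "insert q F \<subseteq> ?P" using qP by (auto simp: F_def)
  ultimately have hull: "affine hull (insert q F) = affine hull ?P"
    by (intro affine_dim_equal) (auto simp: hull_mono)
  \<comment> \<open>The combination of \<open>c\<close> and \<open>d\<close> that is constant on \<open>insert q F\<close>, hence on all of \<open>cut_dominant G\<close>.\<close>
  define a where "a = d $ e *\<^sub>R c - c $ e *\<^sub>R d"
  have "affine hull (insert q F) \<subseteq> {x. a \<bullet> x = d $ e * ?g}"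
  proof (rule hull_minimal)
    show "insert q F \<subseteq> {x. a \<bullet> x = d $ e * ?g}"
      using p dF dq by (auto simp: a_def inner_diff_left F_def q_def inner_add_right inner_axis algebra_simps)
  qed (rule affine_hyperplane)
  then have aP: "a \<bullet> x = d $ e * ?g" if "x \<in> ?P" for x
    using that hull hull_subset[of ?P affine] by blast
  have aE: "a $ f = 0" if "f \<in> edges G" for f
  proof -
    have "p + axis f 1 \<in> ?P" using cut_dominant_add_axis p that by (simp add: F_def)
    from aP[OF this] aP[of p] p show ?thesis by (simp add: F_def inner_add_right inner_axis)
  qed
  have "a \<bullet> q = 0"
    unfolding inner_vec_def
  proof (intro sum.neutral ballI)
    fix f show "a $ f \<bullet> q $ f = 0"
      using aE qP cut_dominant_subset by (cases "f \<in> edges G") (auto simp: edge_space_def)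
  qed
  then show False using aP[OF qP] e g by simp
qed

text \<open>The dimension is squeezed: spanning tight cuts bound the affine dimension of the face
  from below by that of the edge space minus one, and a point of the dominant off the supporting
  hyperplane shows that the dominant, which lies in the edge space, is larger by at least
  one.\<close>

lemma defines_facet_if_rigid:
  assumes rigid: "\<forall>d\<in>edge_space (edges G). (\<forall>D\<in>tight_cuts c G. weight d D = 0) \<longrightarrow> d = 0"
  shows "defines_facet c (min_cut_weight c G) (cut_dominant G)"
proof -
  let ?g = "min_cut_weight c G" and ?P = "cut_dominant G" and ?U = "edge_space (edges G)"
  let ?K = "incidence ` tight_cuts c G"
  define F where "F = {x \<in> ?P. c \<bullet> x = ?g}"
  have g: "?g > 0" by (rule min_cut_weight_pos[OF steiner c_pos])
  have KF: "?K \<subseteq> F" using tight_in_face by (auto simp: F_def)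
  obtain D where D: "D \<in> steiner_cuts G" "weight c D = ?g"
    by (rule min_cut_weight_attained[OF steiner])
  then have k: "incidence D \<in> ?K" by (auto simp: tight_cuts_def)
  \<comment> \<open>A proper subspace would leave a nonzero vector of the edge space orthogonal to
    all tight cuts, which rigidity forbids.\<close>
  have KU: "span ?K = ?U"
  proof (rule ccontr)
    assume "span ?K \<noteq> ?U"
    moreover have sub: "span ?K \<subseteq> ?U"
      by (rule span_minimal) (auto simp: edge_space_subspace tight_cuts_def incidence_in_edge_space
        dest: steiner_cuts_subset)
    ultimately have "span ?K \<subset> span ?U"
      using span_eq_iff edge_space_subspace by (metis psubsetI)
    then obtain d where d: "d \<noteq> 0" "d \<in> span ?U" "\<And>x. x \<in> span ?K \<Longrightarrow> orthogonal d x"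
      by (rule orthogonal_to_subspace_exists_gen) auto
    have "d \<in> ?U" using d edge_space_subspace by (metis span_eq_iff)
    moreover have "weight d D = 0" if "D \<in> tight_cuts c G" for D
      using d(3)[of "incidence D"] that by (auto simp: orthogonal_def weight_inner span_base)
    ultimately show False using rigid d by blast
  qed
  have "affine hull F \<subseteq> {x. c \<bullet> x = ?g}"
    by (rule hull_minimal) (auto simp: F_def affine_hyperplane)
  then have zF: "0 \<notin> affine hull F" and on_g: "\<And>x. x \<in> affine hull F \<Longrightarrow> c \<bullet> x = ?g" using g by auto
  then have zK: "0 \<notin> affine hull ?K" using hull_mono[OF KF, of affine] by blast
  \<comment> \<open>The origin lies outside the affine hull because the minimum is positive.
    Adjoining it raises the affine dimension by one and turns it into a linear dimension.\<close>
  have "aff_dim ?K + 1 = aff_dim (insert 0 ?K)" using zK by (simp add: aff_dim_insert)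
  also have "\<dots> = int (dim (insert 0 ?K))" by (intro aff_dim_zero hull_inc) simp
  also have "\<dots> = int (dim ?U)" using KU by (metis dim_span span_insert_0)
  finally have low: "int (dim ?U) - 1 \<le> aff_dim F" using aff_dim_subset[OF KF] by linarith
  have "D \<noteq> {}" "D \<subseteq> edges G" using steiner_cut_nonempty[OF steiner] D steiner_cuts_subset by blast+
  then obtain e where e: "e \<in> edges G" by blast
  define q where "q = incidence D + axis e 1"
  have qP: "q \<in> ?P" using KF k cut_dominant_add_axis e by (auto simp: q_def F_def)
  have "c \<bullet> q = ?g + c $ e" using D by (simp add: q_def inner_add_right inner_axis weight_inner)
  then have "q \<notin> affine hull F" using on_g c_pos e by fastforce
  then have "aff_dim F + 1 = aff_dim (insert q F)" by (simp add: aff_dim_insert)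
  also have "\<dots> \<le> aff_dim ?P" using qP by (intro aff_dim_subset) (auto simp: F_def)
  finally have up: "aff_dim F + 1 \<le> aff_dim ?P" .
  have "aff_dim ?P \<le> aff_dim ?U" using cut_dominant_subset by (rule aff_dim_subset)
  also have "aff_dim ?U = int (dim ?U)" using edge_space_subspace by (rule aff_dim_subspace)
  finally have "aff_dim F = aff_dim ?P - 1" using low up by linarith
  moreover have "F = ?P \<inter> {x. c \<bullet> x = ?g}" by (auto simp: F_def)
  moreover have "?P \<inter> {x. c \<bullet> x = ?g} face_of ?P"
    by (rule face_of_Int_supporting_hyperplane_ge[OF convex_cut_dominant]) (rule cut_dominant_ge)
  moreover have "F \<noteq> {}" using KF k by blast
  ultimately have "F facet_of ?P" by (simp add: facet_of_def)
  then show ?thesis using cut_dominant_ge by (auto simp: defines_facet_def F_def)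
qed

end

text \<open>Positivity of the minimum is automatic for positive weights on a connected graph. The
  later sections work with the right-hand side, where the arithmetic of the weights and the linear
  algebra of the tight cuts are separate.\<close>

theorem provides_facet_weights_iff_rigid:
  assumes "is_steiner_graph G"
  shows "provides_facet_weights c G \<longleftrightarrow> min_integer_form (edges G) c \<and> rigid_weights c G"
  using rigid_if_defines_facet[OF assms] defines_facet_if_rigid[OF assms]
    min_cut_weight_pos[OF assms]
  unfolding provides_facet_weights_def rigid_weights_def min_integer_form_def by blast

section \<open>Scaling and minimum integer form\<close>

lemma min_integer_form_exists:
  assumes x: "x \<in> edge_space E" "\<forall>e\<in>E. x $ e \<in> \<nat>" and pos: "e \<in> E" "x $ e \<noteq> 0"
  obtains r where "r > 0" "min_integer_form E (r *\<^sub>R x)"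
proof -
  have "\<forall>e\<in>E. \<exists>n. x $ e = real n" using x(2) by (auto elim: Nats_cases)
  then obtain k where k: "\<forall>e\<in>E. x $ e = real (k e)" by (rule bchoice[THEN exE])
  define g where "g = Gcd (k ` E)"
  have "k e \<noteq> 0" using pos k by auto
  then have g: "g \<noteq> 0" using pos by (auto simp: g_def Gcd_0_iff)
  define k' where "k' = (\<lambda>e. k e div g)"
  have kk: "k e = g * k' e" if "e \<in> E" for e
    using that by (simp add: k'_def g_def)
  have "g = Gcd ((*) g ` (k' ` E))" unfolding g_def
    by (rule arg_cong[of _ _ Gcd]) (use kk in \<open>auto simp: image_image g_def\<close>)
  also have "\<dots> = g * Gcd (k' ` E)" by (simp add: Gcd_mult)
  finally have "Gcd (k' ` E) = 1" using g by simp
  moreover have "\<forall>e\<in>E. ((1 / real g) *\<^sub>R x) $ e = real (k' e)" using k kk g by simp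
  moreover have "(1 / real g) *\<^sub>R x \<in> edge_space E" using x(1) by (simp add: edge_space_def)
  ultimately show thesis using that[of "1 / real g"] g unfolding min_integer_form_def by auto
qed

lemma min_integer_form_Nats: "min_integer_form E c \<Longrightarrow> e \<in> E \<Longrightarrow> c $ e \<in> \<nat>"
  by (auto simp: min_integer_form_def)

text \<open>The greatest common divisor depends only on the set of values, and subdividing merely
  repeats one of them.\<close>

lemma min_integer_form_same_values:
  assumes "min_integer_form E' c'" "c \<in> edge_space E" "($) c ` E = ($) c' ` E'"
  shows "min_integer_form E c"
proof -
  obtain k' where k': "\<forall>e\<in>E'. c' $ e = real (k' e)" "Gcd (k' ` E') = 1"
    using assms by (auto simp: min_integer_form_def)
  \<comment> \<open>Reading the integer off the weight by rounding gives equal integers to equal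
    weights, so the two images coincide.\<close>
  define k where "k = (\<lambda>e. nat \<lfloor>c $ e\<rfloor>)"
  have "\<forall>e\<in>E. c $ e = real (k e)"
  proof
    fix e assume "e \<in> E"
    then obtain e' where "e' \<in> E'" "c $ e = c' $ e'" using assms(3) by (metis imageE imageI)
    then show "c $ e = real (k e)" using k' by (simp add: k_def)
  qed
  moreover have "k ` E = k' ` E'"
  proof -
    have "k ` E = (\<lambda>r. nat \<lfloor>r\<rfloor>) ` (($) c ` E)" by (simp add: k_def image_image)
    also have "\<dots> = k' ` E'" unfolding assms(3) image_image using k' by (intro image_cong) auto
    finally show ?thesis .
  qed
  ultimately show ?thesis using assms(2) k' unfolding min_integer_form_def by metis
qed

lemma tight_cuts_scaleR:
  assumes "is_steiner_graph G" "r > 0"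
  shows "tight_cuts (r *\<^sub>R c) G = tight_cuts c G"
  using assms by (simp add: tight_cuts_def weight_scaleR min_cut_weight_scaleR)

lemma rigid_weights_scaleR:
  assumes "is_steiner_graph G" "r > 0" "rigid_weights c G"
  shows "rigid_weights (r *\<^sub>R c) G"
  using assms unfolding rigid_weights_def
  by (simp add: tight_cuts_scaleR subspace_scale[OF edge_space_subspace])

text \<open>Otherwise the unit vector of \<open>e\<close> would be a nonzero test vector vanishing
  on all tight cuts. This supplies the tight cuts used at a subdivided edge, on each side of a cut
  node and at a node of degree two.\<close>

lemma rigid_edge_in_tight_cut:
  assumes "rigid_weights c G" "e \<in> edges G"
  obtains D where "D \<in> tight_cuts c G" "e \<in> D"
proof (rule ccontr)
  assume "\<not> thesis"
  then have "\<forall>D\<in>tight_cuts c G. weight (axis e 1) D = 0" using that by (auto simp: weight_axis)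
  moreover have "axis e 1 \<in> edge_space (edges G)" using assms(2) by (rule axis_in_edge_space)
  ultimately have "axis e 1 = (0 :: 'a edge_vector)" using assms(1) by (auto simp: rigid_weights_def)
  then show False by (simp add: axis_eq_0_iff)
qed

section \<open>Subdivision\<close>

text \<open>The weights forced by a subdivision, as an explicit linear map. It carries test vectors
  as well as weights from the old graph to the new one.\<close>

definition subdivided_weights ::
    "('a::finite) set set \<Rightarrow> 'a \<Rightarrow> 'a \<Rightarrow> 'a \<Rightarrow> 'a edge_vector \<Rightarrow> 'a edge_vector" where
  "subdivided_weights E u v w c = (\<chi> e. if e = {u, w} \<or> e = {v, w} then c $ {u, v}
     else if e \<in> E - {{u, v}} then c $ e else 0)"

context
  fixes G' G :: "'a::finite steiner_graph" and u v w :: 'a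
  assumes steiner': "is_steiner_graph G'" and sub: "subdivides_edge G' u v w G"
begin

lemma subdivides_edge_simps:
  "{u, v} \<in> edges G'" "w \<notin> nodes G'" "nodes G = insert w (nodes G')"
  "edges G = (edges G' - {{u, v}}) \<union> {{u, w}, {v, w}}" "terminals G = terminals G'"
  using sub by (auto simp: subdivides_edge_def)

lemma subdivided_edge_ends: "u \<noteq> v" "u \<in> nodes G'" "v \<in> nodes G'" "u \<noteq> w" "v \<noteq> w"
proof -
  obtain x y where xy: "{u, v} = {x, y}" "x \<in> nodes G'" "y \<in> nodes G'" "x \<noteq> y"
    using edge_of_graph[OF steiner' subdivides_edge_simps(1)] by metis
  then show "u \<noteq> v" "u \<in> nodes G'" "v \<in> nodes G'" by (auto simp: doubleton_eq_iff)
  then show "u \<noteq> w" "v \<noteq> w" using subdivides_edge_simps(2) by auto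
qed

lemma subdividing_node_notin_edge: "e \<in> edges G' \<Longrightarrow> w \<notin> e"
  using edges_simple[OF steiner'] subdivides_edge_simps(2) by auto

lemma subdivision_edges_simple: "edges G \<subseteq> simple_edges (nodes G)"
proof
  fix e assume "e \<in> edges G"
  then consider "e \<in> edges G'" | "e = {u, w}" | "e = {v, w}" by (auto simp: subdivides_edge_simps)
  then show "e \<in> simple_edges (nodes G)"
  proof cases
    case 1
    then obtain x y where "e = {x, y}" "x \<in> nodes G'" "y \<in> nodes G'" "x \<noteq> y"
      by (rule edge_of_graph[OF steiner'])
    then show ?thesis by (auto simp: subdivides_edge_simps)
  qed (use subdivided_edge_ends in \<open>auto simp: subdivides_edge_simps\<close>)
qed

lemma cut_subdivision:
  "cut G S = (cut G' (S - {w}) - {{u, v}}) \<union>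
     (if (u \<in> S) \<noteq> (w \<in> S) then {{u, w}} else {}) \<union> (if (v \<in> S) \<noteq> (w \<in> S) then {{v, w}} else {})"
proof -
  have old: "e \<in> cut G S \<longleftrightarrow> e \<in> cut G' (S - {w}) - {{u, v}}" if "e \<noteq> {u, w}" "e \<noteq> {v, w}" for e
  proof (cases "e \<in> edges G'")
    case True
    then have "e \<inter> S = e \<inter> (S - {w})" using subdividing_node_notin_edge by auto
    then show ?thesis using that True by (auto simp: cut_def subdivides_edge_simps)
  qed (use that in \<open>auto simp: cut_def subdivides_edge_simps\<close>)
  have new: "{u, w} \<notin> cut G' X" "{v, w} \<notin> cut G' X" for X
    using subdividing_node_notin_edge by (auto simp: cut_def)
  have "{u, w} \<in> cut G S \<longleftrightarrow> (u \<in> S) \<noteq> (w \<in> S)" "{v, w} \<in> cut G S \<longleftrightarrow> (v \<in> S) \<noteq> (w \<in> S)"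
    using pair_in_cut[OF subdivided_edge_ends(4)] pair_in_cut[OF subdivided_edge_ends(5)]
    by (auto simp: subdivides_edge_simps)
  moreover have "{u, w} \<noteq> {v, w}" using subdivided_edge_ends by (auto simp: doubleton_eq_iff)
  ultimately show ?thesis using old new by (intro set_eqI) (smt (verit) Diff_iff UnCI UnE empty_iff singletonD singletonI)
qed

lemma weight_cut_subdivision:
  "weight d (cut G S) = weight d (cut G' (S - {w}) - {{u, v}}) +
     (if (u \<in> S) \<noteq> (w \<in> S) then d $ {u, w} else 0) + (if (v \<in> S) \<noteq> (w \<in> S) then d $ {v, w} else 0)"
proof -
  have new: "{u, w} \<notin> cut G' X" "{v, w} \<notin> cut G' X" for X
    using subdividing_node_notin_edge by (auto simp: cut_def)
  have "{u, w} \<noteq> {v, w}" using subdivided_edge_ends by (auto simp: doubleton_eq_iff)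
  then show ?thesis using new by (auto simp: cut_subdivision weight_def sum.insert_if)
qed

lemma weight_cut_subdivided_edge:
  "weight d (cut G' S) =
     weight d (cut G' S - {{u, v}}) + (if (u \<in> S) \<noteq> (v \<in> S) then d $ {u, v} else 0)"
proof -
  have "{u, v} \<in> cut G' S \<longleftrightarrow> (u \<in> S) \<noteq> (v \<in> S)"
    using pair_in_cut subdivided_edge_ends subdivides_edge_simps(1) by metis
  then show ?thesis by (auto simp: weight_def sum_diff1)
qed

text \<open>On the path from \<open>u\<close> over \<open>w\<close> to \<open>v\<close>, separated
  ends are paid for once, like the old edge. If \<open>w\<close> is opposite to both ends, the path
  costs twice the old weight where the old edge costs nothing.\<close>

lemma weight_cut_subdivided_weights:
  "weight (subdivided_weights (edges G') u v w d) (cut G S) = weight d (cut G' (S - {w})) +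
     (if (u \<in> S) \<noteq> (w \<in> S) \<and> (v \<in> S) \<noteq> (w \<in> S) then 2 * d $ {u, v} else 0)"
proof -
  have "weight (subdivided_weights (edges G') u v w d) (cut G' X - {{u, v}}) =
      weight d (cut G' X - {{u, v}})" for X
    unfolding weight_def
  proof (rule sum.cong)
    fix e assume "e \<in> cut G' X - {{u, v}}"
    then have "e \<in> edges G' - {{u, v}}" "w \<notin> e"
      using subdividing_node_notin_edge by (auto simp: cut_def)
    then show "subdivided_weights (edges G') u v w d $ e = d $ e"
      by (auto simp: subdivided_weights_def)
  qed simp
  then show ?thesis
    unfolding weight_cut_subdivision weight_cut_subdivided_edge
    using subdivided_edge_ends by (auto simp: subdivided_weights_def)
qed

lemma subdivision_steiner: "is_steiner_graph G"
proof -
  have "\<exists>e\<in>edges G. e \<inter> S \<noteq> {} \<and> e - S \<noteq> {}" if S: "S \<subseteq> nodes G" "S \<noteq> {}" "S \<noteq> nodes G" for S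
  proof -
    have "cut G S \<noteq> {}"
    proof (cases "(u \<in> S) = (w \<in> S) \<and> (v \<in> S) = (w \<in> S)")
      case True
      then have "S - {w} \<subseteq> nodes G'" "S - {w} \<noteq> {}" "S - {w} \<noteq> nodes G'"
        using S subdivided_edge_ends by (auto simp: subdivides_edge_simps)
      then have "cut G' (S - {w}) \<noteq> {}" by (rule cut_nonempty[OF steiner'])
      moreover have "{u, v} \<notin> cut G' (S - {w})"
        using True pair_in_cut subdivided_edge_ends by (metis Diff_iff singletonD)
      ultimately show ?thesis unfolding cut_subdivision by auto
    qed (auto simp: cut_subdivision)
    then obtain e where "e \<in> cut G S" by blast
    then show ?thesis using in_cut_iff[OF subdivision_edges_simple] by blast
  qed
  then have "connected_graph (nodes G) (edges G)"
    unfolding connected_graph_iff_cuts[OF subdivision_edges_simple]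
    by (auto simp: subdivides_edge_simps)
  then show ?thesis
    using subdivision_edges_simple terminals_subset[OF steiner'] terminals_card[OF steiner']
    unfolding is_steiner_graph_def by (auto simp: subdivides_edge_simps)
qed

lemma terminals_minus_subdividing_node:
  "terminals G \<inter> S = terminals G' \<inter> (S - {w})" "terminals G - S = terminals G' - (S - {w})"
  using terminals_subset[OF steiner'] by (auto simp: subdivides_edge_simps)

lemma steiner_cut_subdivisionE:
  assumes "D \<in> steiner_cuts G"
  obtains S where "D = cut G S" "cut G' (S - {w}) \<in> steiner_cuts G'"
proof -
  obtain S where "S \<subseteq> nodes G" "terminals G \<inter> S \<noteq> {}" "terminals G - S \<noteq> {}" "D = cut G S"
    using assms by (auto simp: steiner_cuts_def)
  then show thesis using that[of S]
    unfolding terminals_minus_subdividing_node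
    by (force simp: subdivides_edge_simps intro!: steiner_cutI[OF steiner'])
qed

lemma steiner_cut_subdivisionI:
  assumes "D \<in> steiner_cuts G'"
  obtains S where "w \<notin> S" "D = cut G' S" "cut G S \<in> steiner_cuts G" "cut G (insert w S) \<in> steiner_cuts G"
proof -
  obtain S where S: "S \<subseteq> nodes G'" "terminals G' \<inter> S \<noteq> {}" "terminals G' - S \<noteq> {}" "D = cut G' S"
    using assms by (auto simp: steiner_cuts_def)
  have w: "w \<notin> S" using S subdivides_edge_simps(2) by auto
  then have "S - {w} = S" "insert w S - {w} = S" by auto
  then show thesis using that[of S] S w
    by (metis (no_types, lifting) insert_mono subdivides_edge_simps(3) subset_insertI2
        steiner_cutI[OF subdivision_steiner] terminals_minus_subdividing_node)
qed

context
  fixes c' :: "'a edge_vector"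
  assumes c'_pos: "\<forall>e\<in>edges G'. c' $ e > 0"
begin

abbreviation (input) "c_sub \<equiv> subdivided_weights (edges G') u v w c'"

lemma weight_cut_subdivided_weights_ge: "weight c_sub (cut G S) \<ge> weight c' (cut G' (S - {w}))"
  using c'_pos subdivides_edge_simps(1) by (simp add: weight_cut_subdivided_weights less_imp_le)

lemma min_cut_weight_subdivision: "min_cut_weight c_sub G = min_cut_weight c' G'"
proof -
  obtain D where D: "D \<in> steiner_cuts G'" "weight c' D = min_cut_weight c' G'"
    by (rule min_cut_weight_attained[OF steiner'])
  obtain S where S: "w \<notin> S" "D = cut G' S" "cut G S \<in> steiner_cuts G" "cut G (insert w S) \<in> steiner_cuts G"
    by (rule steiner_cut_subdivisionI[OF D(1)])
  have w: "insert w S - {w} = S" "S - {w} = S" using S by auto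
  \<comment> \<open>\<open>w\<close> joins the side of \<open>u\<close>, so it is never opposite to
    both neighbours and the surcharge is zero.\<close>
  define R where "R = (if u \<in> S then insert w S else S)"
  have "cut G R \<in> steiner_cuts G" using S by (simp add: R_def)
  moreover have "weight c_sub (cut G R) = min_cut_weight c' G'"
    using D S w subdivided_edge_ends by (auto simp: R_def weight_cut_subdivided_weights)
  moreover have "weight c_sub D \<ge> min_cut_weight c' G'" if D: "D \<in> steiner_cuts G" for D
  proof -
    obtain S where "D = cut G S" "cut G' (S - {w}) \<in> steiner_cuts G'"
      by (rule steiner_cut_subdivisionE[OF D])
    then show ?thesis using weight_cut_subdivided_weights_ge[of S]
        min_cut_weight_le[OF steiner', of "cut G' (S - {w})" c'] by simp
  qed
  ultimately show ?thesis using min_cut_weight_eqI[OF subdivision_steiner] by blast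
qed

text \<open>A test vector \<open>d\<close> of the new graph first turns out to agree on the two
  halves of the subdivided edge. It is then the image of a vector \<open>d'\<close> of the old
  graph, which vanishes on the old tight cuts and is therefore zero.\<close>

lemma rigid_weights_subdivision:
  assumes rigid: "rigid_weights c' G'"
  shows "rigid_weights c_sub G"
  unfolding rigid_weights_def
proof (intro conjI ballI impI)
  show "c_sub \<in> edge_space (edges G)"
    by (auto simp: edge_space_def subdivided_weights_def subdivides_edge_simps)
  show "c_sub $ e > 0" if "e \<in> edges G" for e
    using that c'_pos subdivides_edge_simps(1)
    by (auto simp: subdivided_weights_def subdivides_edge_simps(4))
next
  fix d assume d: "d \<in> edge_space (edges G)" and d0: "\<forall>D\<in>tight_cuts c_sub G. weight d D = 0"
  define d' where "d' = (\<chi> e. if e = {u, v} then d $ {u, w} else if e \<in> edges G' then d $ e else 0)"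
  have tight: "weight d (cut G S) = 0"
    if "cut G S \<in> steiner_cuts G" "weight c' (cut G' (S - {w})) = min_cut_weight c' G'"
       "\<not> ((u \<in> S) \<noteq> (w \<in> S) \<and> (v \<in> S) \<noteq> (w \<in> S))" for S
  proof -
    have "weight c_sub (cut G S) = min_cut_weight c_sub G"
      using that by (auto simp: weight_cut_subdivided_weights min_cut_weight_subdivision)
    then show ?thesis using that(1) d0 by (simp add: tight_cuts_def)
  qed
  \<comment> \<open>In a tight cut through the old edge, \<open>w\<close> may be put on either side
    at the same cost. The two resulting tight cuts differ only in which half they contain, so
    \<open>d\<close> agrees on the halves.\<close>
  obtain D where D: "D \<in> tight_cuts c' G'" "{u, v} \<in> D"
    by (rule rigid_edge_in_tight_cut[OF rigid subdivides_edge_simps(1)])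
  have "D \<in> steiner_cuts G'" using D by (simp add: tight_cuts_def)
  then obtain S where S: "w \<notin> S" "D = cut G' S" "cut G S \<in> steiner_cuts G" "cut G (insert w S) \<in> steiner_cuts G"
    by (rule steiner_cut_subdivisionI)
  have w: "insert w S - {w} = S" "S - {w} = S" using S by auto
  have uv: "(u \<in> S) \<noteq> (v \<in> S)" using D S pair_in_cut subdivided_edge_ends by metis
  have "weight c' (cut G' S) = min_cut_weight c' G'" using D S by (simp add: tight_cuts_def)
  then have "weight d (cut G S) = 0" "weight d (cut G (insert w S)) = 0"
    using tight[of S] tight[of "insert w S"] S uv w subdivided_edge_ends by auto
  then have eq: "d $ {u, w} = d $ {v, w}"
    unfolding weight_cut_subdivision w using uv subdivided_edge_ends S(1) by (auto split: if_splits)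
  have dd: "d = subdivided_weights (edges G') u v w d'"
    unfolding vec_eq_iff
  proof
    fix e show "d $ e = subdivided_weights (edges G') u v w d' $ e"
    proof (cases "e \<in> edges G")
      case True
      then show ?thesis using eq by (auto simp: subdivided_weights_def d'_def subdivides_edge_simps(4))
    next
      case False
      then show ?thesis using d
        by (auto simp: subdivided_weights_def subdivides_edge_simps(4) edge_space_def)
    qed
  qed
  have "weight d' D = 0" if D: "D \<in> tight_cuts c' G'" for D
  proof -
    have "D \<in> steiner_cuts G'" using D by (simp add: tight_cuts_def)
    then obtain S where S: "w \<notin> S" "D = cut G' S" "cut G S \<in> steiner_cuts G" "cut G (insert w S) \<in> steiner_cuts G"
      by (rule steiner_cut_subdivisionI)
    have w: "insert w S - {w} = S" "S - {w} = S" using S by auto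
    have m: "weight c' (cut G' S) = min_cut_weight c' G'" using D S by (simp add: tight_cuts_def)
    define R where "R = (if u \<in> S then insert w S else S)"
    have "weight d (cut G R) = 0"
      using tight[of R] S m w subdivided_edge_ends by (auto simp: R_def)
    then show ?thesis
      unfolding dd weight_cut_subdivided_weights using S w subdivided_edge_ends
      by (auto simp: R_def split: if_splits)
  qed
  moreover have "d' \<in> edge_space (edges G')"
    using subdivides_edge_simps(1) by (auto simp: d'_def edge_space_def)
  ultimately have "d' = 0" using rigid by (auto simp: rigid_weights_def)
  then show "d = 0" unfolding dd by (auto simp: subdivided_weights_def vec_eq_iff)
qed

text \<open>In a tight cut of the new graph \<open>w\<close> is not opposite to both neighbours,
  since the surcharge is positive. So every such cut comes from an old tight cut, and images of old
  test vectors vanish on it.\<close>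

lemma rigid_weights_subdivisionD:
  assumes rigid: "rigid_weights c_sub G" and c': "c' \<in> edge_space (edges G')"
  shows "rigid_weights c' G'"
  unfolding rigid_weights_def
proof (intro conjI c' c'_pos ballI impI)
  fix d' assume d': "d' \<in> edge_space (edges G')" and d'0: "\<forall>D\<in>tight_cuts c' G'. weight d' D = 0"
  let ?d = "subdivided_weights (edges G') u v w d'"
  have "?d \<in> edge_space (edges G)"
    by (auto simp: edge_space_def subdivided_weights_def subdivides_edge_simps)
  moreover have "weight ?d D = 0" if D: "D \<in> tight_cuts c_sub G" for D
  proof -
    have "D \<in> steiner_cuts G" using D by (simp add: tight_cuts_def)
    then obtain S where S: "D = cut G S" "cut G' (S - {w}) \<in> steiner_cuts G'"
      by (rule steiner_cut_subdivisionE)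
    have "weight c_sub (cut G S) = min_cut_weight c' G'"
      using D S by (simp add: tight_cuts_def min_cut_weight_subdivision)
    moreover have "c' $ {u, v} > 0" using c'_pos subdivides_edge_simps(1) by blast
    moreover have "min_cut_weight c' G' \<le> weight c' (cut G' (S - {w}))"
      using S by (intro min_cut_weight_le[OF steiner'])
    ultimately have "\<not> ((u \<in> S) \<noteq> (w \<in> S) \<and> (v \<in> S) \<noteq> (w \<in> S))"
      and "weight c' (cut G' (S - {w})) = min_cut_weight c' G'"
      by (auto simp: weight_cut_subdivided_weights split: if_splits)
    then show ?thesis using S d'0 by (auto simp: weight_cut_subdivided_weights tight_cuts_def)
  qed
  ultimately have d0: "?d = 0" using rigid by (auto simp: rigid_weights_def)
  show "d' = 0"
    unfolding vec_eq_iff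
  proof
    fix e
    have "?d $ {u, w} = 0" "?d $ e = 0" using d0 by simp_all
    then show "d' $ e = 0 $ e" using d' subdividing_node_notin_edge[of e]
      by (cases "e \<in> edges G'"; cases "e = {u, v}")
        (auto simp: subdivided_weights_def edge_space_def split: if_splits)
  qed
qed

end

lemma subdivided_weights_values:
  "($) (subdivided_weights (edges G') u v w c) ` edges G = ($) c ` edges G'"
proof -
  have "subdivided_weights (edges G') u v w c $ e = c $ e" if "e \<in> edges G' - {{u, v}}" for e
    using that subdividing_node_notin_edge by (auto simp: subdivided_weights_def)
  then have "($) (subdivided_weights (edges G') u v w c) ` (edges G' - {{u, v}}) =
      ($) c ` (edges G' - {{u, v}})" by (rule image_cong[OF refl])
  moreover have "($) c ` edges G' = insert (c $ {u, v}) (($) c ` (edges G' - {{u, v}}))"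
    using subdivides_edge_simps(1) by blast
  moreover have "subdivided_weights (edges G') u v w c $ {u, w} = c $ {u, v}"
    "subdivided_weights (edges G') u v w c $ {v, w} = c $ {u, v}"
    by (simp_all add: subdivided_weights_def)
  ultimately show ?thesis
    unfolding subdivides_edge_simps(4) image_Un by simp
qed

end

lemma subdivision_weighted_iff:
  "subdivision_weighted (G', c') (G, c) \<longleftrightarrow>
     (\<exists>u v w. subdivides_edge G' u v w G \<and> c = subdivided_weights (edges G') u v w c')"
  if "is_steiner_graph G'"
proof -
  have "c \<in> edge_space (edges G) \<and> c $ {u, w} = c' $ {u, v} \<and> c $ {v, w} = c' $ {u, v} \<and>
     (\<forall>e \<in> edges G' - {{u, v}}. c $ e = c' $ e) \<longleftrightarrow> c = subdivided_weights (edges G') u v w c'"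
     (is "?L \<longleftrightarrow> ?R")
    if sub: "subdivides_edge G' u v w G" for u v w
  proof
    show "?L" if ?R
      using subdividing_node_notin_edge[OF \<open>is_steiner_graph G'\<close> sub]
        subdivides_edge_simps[OF \<open>is_steiner_graph G'\<close> sub] unfolding that
      by (auto simp: subdivided_weights_def edge_space_def)
    show "?R" if ?L
      using that subdivides_edge_simps(4)[OF \<open>is_steiner_graph G'\<close> sub]
      by (auto simp: subdivided_weights_def edge_space_def vec_eq_iff)
  qed
  then show ?thesis unfolding subdivision_weighted_def prod.case
    by (intro ex_cong1 conj_cong refl)
qed

section \<open>Gluing\<close>

text \<open>\<open>gluing\<close> with its node as a parameter, so that the node can be fixed
  throughout and the two pieces exchanged.\<close>

definition glued_at ::
    "'a \<Rightarrow> 'a steiner_graph \<Rightarrow> 'a steiner_graph \<Rightarrow> 'a steiner_graph \<Rightarrow> bool" where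
  "glued_at w G1 G2 G \<longleftrightarrow>
     nodes G1 \<inter> nodes G2 = {w} \<and> w \<in> terminals G1 \<inter> terminals G2 \<and>
     nodes G = nodes G1 \<union> nodes G2 \<and>
     edges G = edges G1 \<union> edges G2 \<and>
     (terminals G = terminals G1 \<union> terminals G2 \<or>
      terminals G = (terminals G1 \<union> terminals G2) - {w})"

lemma gluing_iff_glued_at: "gluing G1 G2 G \<longleftrightarrow> (\<exists>w. glued_at w G1 G2 G)"
  by (simp add: gluing_def glued_at_def)

lemma glued_at_commute: "glued_at w G1 G2 G \<Longrightarrow> glued_at w G2 G1 G"
  unfolding glued_at_def by (simp add: Int_commute Un_commute)

lemma other_terminal:
  assumes "is_steiner_graph G"
  obtains t where "t \<in> terminals G" "t \<noteq> w"
proof -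
  have "\<not> terminals G \<subseteq> {w}"
    using terminals_card[OF assms] card_mono[of "{w}" "terminals G"] by auto
  then show thesis using that by blast
qed

lemma cut_restrict_nodes:
  assumes "is_steiner_graph G"
  shows "cut G (S \<inter> nodes G) = cut G S"
proof -
  have "e \<inter> (S \<inter> nodes G) = e \<inter> S" if "e \<in> edges G" for e
    using edges_simple[OF assms] that by auto
  then show ?thesis by (auto simp: cut_def)
qed

context
  fixes G1 G2 G :: "'a::finite steiner_graph" and w :: 'a
  assumes steiner1: "is_steiner_graph G1" and steiner2: "is_steiner_graph G2"
    and glued: "glued_at w G1 G2 G"
begin

lemma glued_simps:
  "nodes G1 \<inter> nodes G2 = {w}" "w \<in> terminals G1" "w \<in> terminals G2"
  "nodes G = nodes G1 \<union> nodes G2" "edges G = edges G1 \<union> edges G2"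
  using glued by (auto simp: glued_at_def)

lemma glued_terminals:
  "terminals G \<subseteq> terminals G1 \<union> terminals G2"
  "(terminals G1 \<union> terminals G2) - {w} \<subseteq> terminals G"
  using glued by (auto simp: glued_at_def)

lemma glued_edges_disjoint: "edges G1 \<inter> edges G2 = {}"
proof (rule ccontr)
  assume "edges G1 \<inter> edges G2 \<noteq> {}"
  then obtain e where e: "e \<in> edges G1" "e \<in> edges G2" by blast
  obtain x y where "e = {x, y}" "x \<in> nodes G1" "y \<in> nodes G1" "x \<noteq> y"
    using edge_of_graph[OF steiner1 e(1)] by metis
  moreover obtain x' y' where "e = {x', y'}" "x' \<in> nodes G2" "y' \<in> nodes G2"
    using edge_of_graph[OF steiner2 e(2)] by metis
  ultimately have "x \<in> {w}" "y \<in> {w}" using glued_simps(1) by auto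
  then show False using \<open>x \<noteq> y\<close> by simp
qed

lemma cut_glued: "cut G S = cut G1 S \<union> cut G2 S"
  by (auto simp: cut_def glued_simps)

lemma glued_edges_simple: "edges G \<subseteq> simple_edges (nodes G)"
proof -
  have "simple_edges (nodes G1) \<subseteq> simple_edges (nodes G)" "simple_edges (nodes G2) \<subseteq> simple_edges (nodes G)"
    unfolding glued_simps by fast+
  then show ?thesis
    using edges_simple[OF steiner1] edges_simple[OF steiner2] unfolding glued_simps(5)
    by (meson Un_least subset_trans)
qed

text \<open>If the gluing drops \<open>w\<close> as a terminal, another terminal of
  \<open>G2\<close> replaces it in the count; it exists because \<open>G2\<close> has at least
  two.\<close>

lemma glued_terminals_card: "card (terminals G1) \<le> card (terminals G)"
proof -
  obtain t where t: "t \<in> terminals G2" "t \<noteq> w" by (rule other_terminal[OF steiner2])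
  then have "t \<notin> terminals G1"
    using glued_simps(1) terminals_subset[OF steiner1] terminals_subset[OF steiner2] by auto
  then have "card (insert t (terminals G1 - {w})) = card (terminals G1)"
    using glued_simps(2) card_Suc_Diff1[of "terminals G1" w] by simp
  moreover have "insert t (terminals G1 - {w}) \<subseteq> terminals G" using glued_terminals(2) t by auto
  ultimately show ?thesis using card_mono[of "terminals G" "insert t (terminals G1 - {w})"] by simp
qed

lemma glued_steiner: "is_steiner_graph G"
proof -
  have "\<exists>e\<in>edges G. e \<inter> S \<noteq> {} \<and> e - S \<noteq> {}" if S: "S \<subseteq> nodes G" "S \<noteq> {}" "S \<noteq> nodes G" for S
  proof -
    \<comment> \<open>The pieces share \<open>w\<close>, so a set that is trivial on both of them
      would be trivial on \<open>G\<close>; hence some piece is properly cut.\<close>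
    have w: "w \<in> nodes G1" "w \<in> nodes G2" using glued_simps(1) by auto
    have "\<not> ((S \<inter> nodes G1 = {} \<or> S \<inter> nodes G1 = nodes G1) \<and>
        (S \<inter> nodes G2 = {} \<or> S \<inter> nodes G2 = nodes G2))"
      using S w unfolding glued_simps by blast
    then have "cut G1 (S \<inter> nodes G1) \<noteq> {} \<or> cut G2 (S \<inter> nodes G2) \<noteq> {}"
      using cut_nonempty[OF steiner1] cut_nonempty[OF steiner2] by (metis inf_le2)
    then have "cut G S \<noteq> {}"
      by (auto simp: cut_glued cut_restrict_nodes steiner1 steiner2)
    then obtain e where "e \<in> cut G S" by blast
    then show ?thesis using in_cut_iff[OF glued_edges_simple] by blast
  qed
  moreover have "nodes G \<noteq> {}" using glued_simps by blast
  ultimately have "connected_graph (nodes G) (edges G)"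
    unfolding connected_graph_iff_cuts[OF glued_edges_simple] by blast
  moreover have "terminals G \<subseteq> nodes G"
    using glued_terminals(1) terminals_subset[OF steiner1] terminals_subset[OF steiner2]
    unfolding glued_simps by blast
  moreover have "card (terminals G) \<ge> 2"
    using glued_terminals_card terminals_card[OF steiner1] by linarith
  ultimately show ?thesis using glued_edges_simple unfolding is_steiner_graph_def by blast
qed

text \<open>The shore without \<open>w\<close> touches no edge of \<open>G2\<close>, and a terminal
  of \<open>G2\<close> other than \<open>w\<close> lies on the far side even if the gluing drops
  \<open>w\<close> from the terminals.\<close>

lemma steiner_cut_glued:
  assumes D: "D \<in> steiner_cuts G1"
  shows "D \<in> steiner_cuts G"
proof -
  obtain S where S: "S \<subseteq> nodes G1" "w \<notin> S" "terminals G1 \<inter> S \<noteq> {}" "D = cut G1 S"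
    by (rule steiner_cut_avoiding[OF steiner1 D])
  obtain t where t: "t \<in> terminals G2" "t \<noteq> w" by (rule other_terminal[OF steiner2])
  then have "t \<notin> nodes G1" using glued_simps(1) terminals_subset[OF steiner2] by auto
  then have "t \<in> terminals G - S" using t S glued_terminals(2) by auto
  moreover have "terminals G \<inter> S \<noteq> {}" using S glued_terminals(2) by auto
  moreover have "S \<subseteq> nodes G" using S by (auto simp: glued_simps)
  ultimately have "cut G S \<in> steiner_cuts G" by (auto simp: steiner_cuts_def)
  moreover have "cut G2 S = {}"
  proof -
    have "S \<inter> nodes G2 = {}" using S glued_simps(1) by auto
    then show ?thesis using cut_restrict_nodes[OF steiner2, of S] by (simp add: cut_def)
  qed
  ultimately show ?thesis by (simp add: cut_glued S)
qed

text \<open>\<open>w\<close> is a terminal of \<open>G1\<close> in either variant of the gluing, so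
  it serves as the terminal on the far side.\<close>

lemma steiner_cut_of_glued:
  assumes S: "t \<in> terminals G1" "t \<in> S" "w \<notin> S"
  shows "cut G1 S \<in> steiner_cuts G1"
proof -
  have "t \<in> terminals G1 \<inter> (S \<inter> nodes G1)" "w \<in> terminals G1 - (S \<inter> nodes G1)"
    using S glued_simps(2) terminals_subset[OF steiner1] by auto
  then have "cut G1 (S \<inter> nodes G1) \<in> steiner_cuts G1"
    by (intro steiner_cutI[OF steiner1]) auto
  then show ?thesis by (simp add: cut_restrict_nodes steiner1)
qed

end

section \<open>Weights and tight cuts of a glued graph\<close>

definition restrict_weights :: "('a::finite) set set \<Rightarrow> 'a edge_vector \<Rightarrow> 'a edge_vector" where
  "restrict_weights E c = (\<chi> e. if e \<in> E then c $ e else 0)"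

lemma restrict_weights_in_edge_space: "restrict_weights E c \<in> edge_space E"
  by (simp add: restrict_weights_def edge_space_def)

lemma weight_restrict: "D \<subseteq> E \<Longrightarrow> weight (restrict_weights E c) D = weight c D"
  unfolding weight_def restrict_weights_def by (intro sum.cong) auto

lemma weight_cong: "(\<And>e. e \<in> D \<Longrightarrow> c $ e = d $ e) \<Longrightarrow> weight c D = weight d D"
  unfolding weight_def by (rule sum.cong) auto

context
  fixes G1 G2 G :: "'a::finite steiner_graph" and w :: 'a and c1 c2 :: "'a edge_vector"
  assumes steiner1: "is_steiner_graph G1" and steiner2: "is_steiner_graph G2"
    and glued: "glued_at w G1 G2 G"
    and rigid1: "rigid_weights c1 G1" and rigid2: "rigid_weights c2 G2"
begin

abbreviation (input) "c_glued \<equiv> min_cut_weight c2 G2 *\<^sub>R c1 + min_cut_weight c1 G1 *\<^sub>R c2"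

lemma glued_weights_1: "e \<in> edges G1 \<Longrightarrow> c_glued $ e = min_cut_weight c2 G2 * c1 $ e"
  and glued_weights_2: "e \<in> edges G2 \<Longrightarrow> c_glued $ e = min_cut_weight c1 G1 * c2 $ e"
  using rigid1 rigid2 glued_edges_disjoint[OF steiner1 steiner2 glued]
  by (auto simp: rigid_weights_def edge_space_def)

lemma weight_glued_1: "D \<subseteq> edges G1 \<Longrightarrow> weight c_glued D = min_cut_weight c2 G2 * weight c1 D"
  and weight_glued_2: "D \<subseteq> edges G2 \<Longrightarrow> weight c_glued D = min_cut_weight c1 G1 * weight c2 D"
  using weight_cong[of D c_glued "min_cut_weight c2 G2 *\<^sub>R c1"]
    weight_cong[of D c_glued "min_cut_weight c1 G1 *\<^sub>R c2"] glued_weights_1 glued_weights_2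
  by (auto simp: weight_scaleR subset_iff simp del: vector_add_component)

lemma min_cut_weights_glued_pos: "min_cut_weight c1 G1 > 0" "min_cut_weight c2 G2 > 0"
  using rigid1 rigid2 min_cut_weight_pos[OF steiner1] min_cut_weight_pos[OF steiner2]
  by (auto simp: rigid_weights_def)

text \<open>Each scale factor is the minimum of the other piece, so both pieces attain the same
  minimum. A Steiner cut whose shore avoids \<open>w\<close> has a terminal of that shore in one
  piece, pays at least this minimum there and a nonnegative amount in the other piece.\<close>

lemma min_cut_weight_glued: "min_cut_weight c_glued G = min_cut_weight c1 G1 * min_cut_weight c2 G2"
proof -
  note steiner = glued_steiner[OF steiner1 steiner2 glued]
  have pos1: "\<forall>e\<in>edges G1. c1 $ e > 0" and pos2: "\<forall>e\<in>edges G2. c2 $ e > 0"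
    using rigid1 rigid2 by (auto simp: rigid_weights_def)
  obtain D where D: "D \<in> steiner_cuts G1" "weight c1 D = min_cut_weight c1 G1"
    by (rule min_cut_weight_attained[OF steiner1])
  show ?thesis
  proof (rule min_cut_weight_eqI[OF steiner])
    show "D \<in> steiner_cuts G" by (rule steiner_cut_glued[OF steiner1 steiner2 glued D(1)])
    show "weight c_glued D = min_cut_weight c1 G1 * min_cut_weight c2 G2"
      using weight_glued_1[OF steiner_cuts_subset[OF D(1)]] D(2) by simp
  next
    fix D assume "D \<in> steiner_cuts G"
    then obtain S where S: "S \<subseteq> nodes G" "w \<notin> S" "terminals G \<inter> S \<noteq> {}" "D = cut G S"
      using steiner_cut_avoiding[OF steiner] by metis
    have "weight c_glued D = weight c_glued (cut G1 S) + weight c_glued (cut G2 S)"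
      unfolding S(4) cut_glued[OF steiner1 steiner2 glued] weight_def
      using glued_edges_disjoint[OF steiner1 steiner2 glued] cut_subset[of G1 S] cut_subset[of G2 S]
      by (intro sum.union_disjoint) auto
    then have eq: "weight c_glued D =
        min_cut_weight c2 G2 * weight c1 (cut G1 S) + min_cut_weight c1 G1 * weight c2 (cut G2 S)"
      by (simp add: weight_glued_1[OF cut_subset] weight_glued_2[OF cut_subset])
    have nn: "weight c1 (cut G1 S) \<ge> 0" "weight c2 (cut G2 S) \<ge> 0"
      using weight_nonneg[OF steiner1 pos1 cut_subset] weight_nonneg[OF steiner2 pos2 cut_subset] by auto
    obtain t where t: "t \<in> terminals G" "t \<in> S" using S by blast
    then consider "t \<in> terminals G1" | "t \<in> terminals G2"
      using glued_terminals(1)[OF steiner1 steiner2 glued] by blast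
    then show "weight c_glued D \<ge> min_cut_weight c1 G1 * min_cut_weight c2 G2"
    proof cases
      case 1
      then have "cut G1 S \<in> steiner_cuts G1"
        using steiner_cut_of_glued[OF steiner1 steiner2 glued] t S by blast
      then have "min_cut_weight c1 G1 \<le> weight c1 (cut G1 S)" by (rule min_cut_weight_le[OF steiner1])
      then have "min_cut_weight c1 G1 * min_cut_weight c2 G2 \<le> min_cut_weight c2 G2 * weight c1 (cut G1 S)"
        using min_cut_weights_glued_pos by (simp add: mult.commute)
      then show ?thesis unfolding eq using nn min_cut_weights_glued_pos by (simp add: add_increasing2)
    next
      case 2
      then have "cut G2 S \<in> steiner_cuts G2"
        using steiner_cut_of_glued[OF steiner2 steiner1 glued_at_commute[OF glued]] t S by blast
      then have "min_cut_weight c2 G2 \<le> weight c2 (cut G2 S)" by (rule min_cut_weight_le[OF steiner2])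
      then have "min_cut_weight c1 G1 * min_cut_weight c2 G2 \<le> min_cut_weight c1 G1 * weight c2 (cut G2 S)"
        using min_cut_weights_glued_pos by simp
      then show ?thesis unfolding eq using nn min_cut_weights_glued_pos by (simp add: add_increasing)
    qed
  qed
qed

lemma tight_cuts_glued:
  "D \<in> tight_cuts c1 G1 \<Longrightarrow> D \<in> tight_cuts c_glued G"
  "D \<in> tight_cuts c2 G2 \<Longrightarrow> D \<in> tight_cuts c_glued G"
  using steiner_cut_glued[OF steiner1 steiner2 glued] weight_glued_1[OF steiner_cuts_subset]
    steiner_cut_glued[OF steiner2 steiner1 glued_at_commute[OF glued]] weight_glued_2[OF steiner_cuts_subset]
  unfolding tight_cuts_def min_cut_weight_glued by auto

text \<open>The restriction of a test vector to either edge set vanishes on the tight cuts of that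
  piece, which are tight in \<open>G\<close>. Rigidity of the pieces kills both restrictions, and
  the two edge sets exhaust the edges.\<close>

lemma rigid_weights_glued: "rigid_weights c_glued G"
  unfolding rigid_weights_def
proof (intro conjI ballI impI)
  note edges = glued_simps(5)[OF steiner1 steiner2 glued]
  show "c_glued \<in> edge_space (edges G)"
    using rigid1 rigid2 by (auto simp: rigid_weights_def edge_space_def edges)
  show "c_glued $ e > 0" if "e \<in> edges G" for e
  proof (cases "e \<in> edges G1")
    case True
    then show ?thesis unfolding glued_weights_1[OF True]
      using rigid1 min_cut_weights_glued_pos by (simp add: rigid_weights_def)
  next
    case False
    then have e: "e \<in> edges G2" using that edges by blast
    then show ?thesis unfolding glued_weights_2[OF e]
      using rigid2 min_cut_weights_glued_pos by (simp add: rigid_weights_def)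
  qed
next
  fix d assume d: "d \<in> edge_space (edges G)" and d0: "\<forall>D\<in>tight_cuts c_glued G. weight d D = 0"
  have "weight (restrict_weights (edges G1) d) D = 0" if D: "D \<in> tight_cuts c1 G1" for D
  proof -
    have "D \<subseteq> edges G1" using D by (auto simp: tight_cuts_def dest: steiner_cuts_subset)
    then show ?thesis using tight_cuts_glued(1)[OF D] d0 by (simp add: weight_restrict)
  qed
  then have "restrict_weights (edges G1) d = 0"
    using rigid1 restrict_weights_in_edge_space unfolding rigid_weights_def by blast
  moreover have "weight (restrict_weights (edges G2) d) D = 0" if D: "D \<in> tight_cuts c2 G2" for D
  proof -
    have "D \<subseteq> edges G2" using D by (auto simp: tight_cuts_def dest: steiner_cuts_subset)
    then show ?thesis using tight_cuts_glued(2)[OF D] d0 by (simp add: weight_restrict)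
  qed
  then have "restrict_weights (edges G2) d = 0"
    using rigid2 restrict_weights_in_edge_space unfolding rigid_weights_def by blast
  ultimately have z: "restrict_weights (edges G1) d $ e = 0" "restrict_weights (edges G2) d $ e = 0" for e
    by simp_all
  have "d $ e = 0" for e
    using z[of e] d glued_simps(5)[OF steiner1 steiner2 glued]
    by (auto simp: restrict_weights_def edge_space_def split: if_splits)
  then show "d = 0" by (simp add: vec_eq_iff)
qed

end

section \<open>Splitting at a cut node\<close>

text \<open>\<open>A\<close> and \<open>B\<close> are complementary nonempty unions of components of
  \<open>G\<close> without \<open>w\<close>. Neither side is required to be connected, so all
  remaining nodes may be collected on the other side.\<close>

definition separates :: "'a steiner_graph \<Rightarrow> 'a \<Rightarrow> 'a set \<Rightarrow> 'a set \<Rightarrow> bool" where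
  "separates G w A B \<longleftrightarrow>
     A \<noteq> {} \<and> B \<noteq> {} \<and> A \<inter> B = {} \<and> w \<notin> A \<and> w \<notin> B \<and> nodes G = insert w (A \<union> B) \<and>
     (\<forall>e\<in>edges G. e \<subseteq> insert w A \<or> e \<subseteq> insert w B)"

text \<open>\<open>w\<close> is made a terminal of the part whatever its status in \<open>G\<close>:
  gluing requires it in both pieces, and the option to drop \<open>w\<close> afterwards restores the
  original terminals.\<close>

definition part :: "'a steiner_graph \<Rightarrow> 'a \<Rightarrow> 'a set \<Rightarrow> 'a steiner_graph" where
  "part G w A = \<lparr>nodes = insert w A, edges = {e \<in> edges G. e \<subseteq> insert w A},
     terminals = insert w (terminals G \<inter> A)\<rparr>"

lemma part_simps [simp]:
  "nodes (part G w A) = insert w A" "edges (part G w A) = {e \<in> edges G. e \<subseteq> insert w A}"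
  "terminals (part G w A) = insert w (terminals G \<inter> A)"
  by (simp_all add: part_def)

lemma separates_commute: "separates G w A B \<Longrightarrow> separates G w B A"
  unfolding separates_def by auto

lemma cut_node_separates:
  assumes steiner: "is_steiner_graph G" and "is_cut_node G w"
  obtains A B where "separates G w A B"
proof -
  let ?V = "nodes G - {w}" and ?E = "{e \<in> edges G. w \<notin> e}"
  have w: "w \<in> nodes G" and ncon: "\<not> connected_graph ?V ?E"
    using assms(2) by (auto simp: is_cut_node_def)
  have simple: "?E \<subseteq> simple_edges ?V"
  proof
    fix e assume e: "e \<in> ?E"
    then obtain x y where "e = {x, y}" "x \<in> nodes G" "y \<in> nodes G" "x \<noteq> y"
      using edge_of_graph[OF steiner] by blast
    then show "e \<in> simple_edges ?V" using e by auto
  qed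
  \<comment> \<open>An empty node set also fails \<open>connected_graph\<close>. A terminal other
    than \<open>w\<close> excludes this case, so the failure comes from an uncrossed set
    \<open>A\<close>.\<close>
  obtain t where "t \<in> terminals G" "t \<noteq> w" by (rule other_terminal[OF steiner])
  then have "?V \<noteq> {}" using terminals_subset[OF steiner] by auto
  then obtain A where A: "A \<subseteq> ?V" "A \<noteq> {}" "A \<noteq> ?V"
    and cross: "\<not> (\<exists>e\<in>?E. e \<inter> A \<noteq> {} \<and> e - A \<noteq> {})"
    using ncon unfolding connected_graph_iff_cuts[OF simple] by blast
  have "e \<subseteq> insert w A \<or> e \<subseteq> insert w (?V - A)" if e: "e \<in> edges G" for e
  proof -
    obtain x y where xy: "e = {x, y}" "x \<in> nodes G" "y \<in> nodes G" "x \<noteq> y"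
      using edge_of_graph[OF steiner e] by metis
    show ?thesis
    proof (cases "w \<in> e")
      case True
      then show ?thesis using xy by auto
    next
      case False
      then have "e \<inter> A = {} \<or> e - A = {}" using cross e by blast
      then show ?thesis using xy False by auto
    qed
  qed
  then have "separates G w A (?V - A)" using A w unfolding separates_def by auto
  then show thesis by (rule that)
qed

context
  fixes G :: "'a::finite steiner_graph" and w :: 'a and A B :: "'a set"
  assumes steiner: "is_steiner_graph G" and sep: "separates G w A B"
begin

lemma separates_simps:
  "A \<noteq> {}" "B \<noteq> {}" "A \<inter> B = {}" "w \<notin> A" "w \<notin> B" "nodes G = insert w (A \<union> B)"
  using sep by (auto simp: separates_def)

lemma separates_edge: "e \<in> edges G \<Longrightarrow> e \<subseteq> insert w A \<or> e \<subseteq> insert w B"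
  using sep by (auto simp: separates_def)

lemma edge_meeting_side:
  assumes "e \<in> edges G" "e \<inter> A \<noteq> {}"
  shows "e \<subseteq> insert w A"
  using separates_edge[OF assms(1)] assms(2) separates_simps by auto

lemma part_edges_disjoint: "edges (part G w A) \<inter> edges (part G w B) = {}"
proof (rule ccontr)
  assume "edges (part G w A) \<inter> edges (part G w B) \<noteq> {}"
  then obtain e where e: "e \<in> edges G" "e \<subseteq> insert w A" "e \<subseteq> insert w B" by auto
  then have "e \<subseteq> {w}" using separates_simps by auto
  moreover obtain x y where "e = {x, y}" "x \<noteq> y"
    using edge_of_graph[OF steiner e(1)] by metis
  ultimately show False by simp
qed

lemma glued_at_parts: "glued_at w (part G w A) (part G w B) G"
proof -
  have "insert w A \<inter> insert w B = {w}" using separates_simps by auto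
  moreover have "edges G = {e \<in> edges G. e \<subseteq> insert w A} \<union> {e \<in> edges G. e \<subseteq> insert w B}"
    using separates_edge by blast
  moreover have "terminals G = insert w (terminals G \<inter> A) \<union> insert w (terminals G \<inter> B) \<or>
      terminals G = insert w (terminals G \<inter> A) \<union> insert w (terminals G \<inter> B) - {w}"
    using terminals_subset[OF steiner] separates_simps by (cases "w \<in> terminals G") auto
  ultimately show ?thesis unfolding glued_at_def part_simps separates_simps(6) by auto
qed

text \<open>An edge leaving \<open>S\<close> meets \<open>A\<close>, and its other end is in
  \<open>A\<close> or at \<open>w\<close>; so a cut inside one side sees only edges of that
  part.\<close>

lemma cut_part:
  assumes "S \<subseteq> A"
  shows "cut (part G w A) S = cut G S"
proof -
  have "e \<subseteq> insert w A" if "e \<in> cut G S" for e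
  proof -
    have "e \<in> edges G" "e \<inter> S \<noteq> {}" using that by (auto simp: in_cut_iff[OF edges_simple[OF steiner]])
    then show ?thesis using edge_meeting_side assms by blast
  qed
  then show ?thesis by (auto simp: cut_def)
qed

lemma edge_across_side: obtains e where "e \<in> edges G" "e \<subseteq> insert w A" "\<not> e \<subseteq> insert w B"
proof -
  have "cut G A \<noteq> {}"
    using separates_simps by (intro cut_nonempty[OF steiner]) auto
  then obtain e where "e \<in> cut G A" by blast
  then have e: "e \<in> edges G" "e \<inter> A \<noteq> {}" by (auto simp: in_cut_iff[OF edges_simple[OF steiner]])
  then have "\<not> e \<subseteq> insert w B" using separates_simps by auto
  then show thesis using that e edge_meeting_side by blast
qed

lemma part_edges_simple: "edges (part G w A) \<subseteq> simple_edges (nodes (part G w A))"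
proof
  fix e assume e: "e \<in> edges (part G w A)"
  then have "e \<in> edges G" by simp
  then obtain x y where "e = {x, y}" "x \<in> nodes G" "y \<in> nodes G" "x \<noteq> y"
    by (rule edge_of_graph[OF steiner])
  then show "e \<in> simple_edges (nodes (part G w A))" using e by auto
qed

lemma part_connected: "connected_graph (nodes (part G w A)) (edges (part G w A))"
proof -
  have "\<exists>e\<in>edges (part G w A). e \<inter> S \<noteq> {} \<and> e - S \<noteq> {}"
    if S: "S \<subseteq> insert w A" "S \<noteq> {}" "S \<noteq> insert w A" for S
  proof -
    \<comment> \<open>Pass to the shore without \<open>w\<close>, which lies inside
      \<open>A\<close>; an edge of \<open>G\<close> crossing it belongs to the part.\<close>
    define S' where "S' = (if w \<in> S then insert w A - S else S)"
    have S': "S' \<subseteq> A" "S' \<noteq> {}" using S by (auto simp: S'_def)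
    then have "cut G S' \<noteq> {}" using separates_simps by (intro cut_nonempty[OF steiner]) auto
    then obtain e where "e \<in> cut G S'" by blast
    then have e: "e \<in> edges G" "e \<inter> S' \<noteq> {}" "e - S' \<noteq> {}"
      by (auto simp: in_cut_iff[OF edges_simple[OF steiner]])
    have "e \<subseteq> insert w A" using e S' edge_meeting_side by blast
    moreover from this have "e \<inter> S \<noteq> {}" "e - S \<noteq> {}"
      using e by (auto simp: S'_def split: if_splits)
    ultimately show ?thesis using e by auto
  qed
  then show ?thesis unfolding connected_graph_iff_cuts[OF part_edges_simple] by simp
qed

lemma part_steiner:
  assumes "terminals G \<inter> A \<noteq> {}"
  shows "is_steiner_graph (part G w A)"
  unfolding is_steiner_graph_def
proof (intro conjI part_connected part_edges_simple)
  show "card (terminals (part G w A)) \<ge> 2"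
    using assms separates_simps by (simp add: card_gt_0_iff Suc_le_eq)
qed auto

lemma cut_split:
  assumes "w \<notin> S"
  shows "cut G S = cut G (S \<inter> A) \<union> cut G (S \<inter> B)"
proof -
  have "card (e \<inter> S) = 1 \<longleftrightarrow> card (e \<inter> (S \<inter> A)) = 1 \<or> card (e \<inter> (S \<inter> B)) = 1" if e: "e \<in> edges G" for e
  proof -
    consider "e \<subseteq> insert w A" | "e \<subseteq> insert w B" using separates_edge[OF e] by blast
    then show ?thesis
    proof cases
      case 1
      then have "e \<inter> (S \<inter> A) = e \<inter> S" "e \<inter> (S \<inter> B) = {}" using assms separates_simps by auto
      then show ?thesis by simp
    next
      case 2
      then have "e \<inter> (S \<inter> B) = e \<inter> S" "e \<inter> (S \<inter> A) = {}" using assms separates_simps by auto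
      then show ?thesis by simp
    qed
  qed
  then show ?thesis by (auto simp: cut_def)
qed

lemma steiner_cut_part:
  assumes "S \<subseteq> A" "terminals G \<inter> S \<noteq> {}"
  shows "cut G S \<in> steiner_cuts (part G w A)"
proof -
  have "cut (part G w A) S \<in> steiner_cuts (part G w A)"
    unfolding steiner_cuts_def
  proof (intro CollectI exI conjI)
    have "w \<in> terminals (part G w A) - S" using assms separates_simps by auto
    then show "terminals (part G w A) - S \<noteq> {}" by blast
  qed (use assms in auto)
  then show ?thesis using cut_part assms by simp
qed

end

text \<open>The portion of \<open>S\<close> in \<open>A\<close> already defines a Steiner cut and
  pays at least the minimum, leaving weight zero for the portion in \<open>B\<close>. As all weights
  are positive, that portion cuts no edge.\<close>

lemma tight_cut_terminal_in_side:
  assumes steiner: "is_steiner_graph G" and sep: "separates G w A B"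
    and pos: "\<forall>e\<in>edges G. c $ e > 0"
    and S: "w \<notin> S" "S \<subseteq> nodes G" "terminals G \<inter> (S \<inter> A) \<noteq> {}" "terminals G - S \<noteq> {}"
    and tight: "weight c (cut G S) = min_cut_weight c G"
  shows "cut G S \<in> steiner_cuts (part G w A)"
proof -
  have "cut G (S \<inter> A) \<in> steiner_cuts G" using S by (intro steiner_cutI[OF steiner]) auto
  then have le: "min_cut_weight c G \<le> weight c (cut G (S \<inter> A))" by (rule min_cut_weight_le[OF steiner])
  have SA: "cut G (S \<inter> A) \<subseteq> edges (part G w A)"
    using cut_part[OF steiner sep, of "S \<inter> A"] cut_subset[of "part G w A"] by auto
  have "cut G (S \<inter> B) \<subseteq> edges (part G w B)"
    using cut_part[OF steiner separates_commute[OF sep], of "S \<inter> B"] cut_subset[of "part G w B"] by auto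
  then have disj: "cut G (S \<inter> A) \<inter> cut G (S \<inter> B) = {}"
    using SA part_edges_disjoint[OF steiner sep] by blast
  have "weight c (cut G S) = weight c (cut G (S \<inter> A)) + weight c (cut G (S \<inter> B))"
    unfolding cut_split[OF steiner sep S(1)] weight_def using disj by (intro sum.union_disjoint) auto
  then have "weight c (cut G (S \<inter> B)) \<le> 0" using le tight by simp
  then have "cut G (S \<inter> B) = {}" using weight_pos[OF steiner pos cut_subset] by (meson not_le)
  then have "cut G S = cut G (S \<inter> A)" using cut_split[OF steiner sep S(1)] by simp
  then show ?thesis using steiner_cut_part[OF steiner sep, of "S \<inter> A"] S by simp
qed

lemma tight_cut_in_part:
  assumes steiner: "is_steiner_graph G" and sep: "separates G w A B"
    and pos: "\<forall>e\<in>edges G. c $ e > 0" and D: "D \<in> tight_cuts c G"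
  shows "D \<in> steiner_cuts (part G w A) \<or> D \<in> steiner_cuts (part G w B)"
proof -
  have "D \<in> steiner_cuts G" and tight: "weight c D = min_cut_weight c G" using D by (auto simp: tight_cuts_def)
  then obtain S where S: "S \<subseteq> nodes G" "w \<notin> S" "terminals G \<inter> S \<noteq> {}" "terminals G - S \<noteq> {}" "D = cut G S"
    using steiner_cut_avoiding[OF steiner] by metis
  then have "terminals G \<inter> (S \<inter> A) \<noteq> {} \<or> terminals G \<inter> (S \<inter> B) \<noteq> {}"
    using separates_simps(6)[OF steiner sep] by auto
  then show ?thesis
  proof
    assume "terminals G \<inter> (S \<inter> A) \<noteq> {}"
    from tight_cut_terminal_in_side[OF steiner sep pos S(2,1) this S(4)] tight S(5)
    show ?thesis by simp
  next
    assume "terminals G \<inter> (S \<inter> B) \<noteq> {}"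
    from tight_cut_terminal_in_side[OF steiner separates_commute[OF sep] pos S(2,1) this S(4)] tight S(5)
    show ?thesis by simp
  qed
qed

text \<open>Some edge belongs only to the side \<open>A\<close>, and rigidity puts it into a tight
  cut, which must then be a Steiner cut of the part on \<open>A\<close>. Without terminals in
  \<open>A\<close> that part would have \<open>w\<close> as its only terminal and hence no Steiner
  cut.\<close>

lemma terminal_in_side:
  assumes steiner: "is_steiner_graph G" and sep: "separates G w A B" and rigid: "rigid_weights c G"
  shows "terminals G \<inter> A \<noteq> {}"
proof
  assume none: "terminals G \<inter> A = {}"
  obtain e where e: "e \<in> edges G" "e \<subseteq> insert w A" "\<not> e \<subseteq> insert w B"
    by (rule edge_across_side[OF steiner sep])
  obtain D where D: "D \<in> tight_cuts c G" "e \<in> D" by (rule rigid_edge_in_tight_cut[OF rigid e(1)])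
  have "D \<notin> steiner_cuts (part G w A)" using none by (auto simp: steiner_cuts_def)
  moreover have "D \<notin> steiner_cuts (part G w B)"
    using e D steiner_cuts_subset[of D "part G w B"] by auto
  moreover have "\<forall>e\<in>edges G. c $ e > 0" using rigid by (simp add: rigid_weights_def)
  ultimately show False using tight_cut_in_part[OF steiner sep _ D(1)] by blast
qed

context
  fixes G :: "'a::finite steiner_graph" and w :: 'a and A B :: "'a set" and c :: "'a edge_vector"
  assumes steiner: "is_steiner_graph G" and sep: "separates G w A B" and rigid: "rigid_weights c G"
begin

lemma rigid_part_steiner: "is_steiner_graph (part G w A)"
  using part_steiner[OF steiner sep terminal_in_side[OF steiner sep rigid]] .

abbreviation (input) "c_part \<equiv> restrict_weights (edges (part G w A)) c"

lemma weight_part_steiner_cut: "D \<in> steiner_cuts (part G w A) \<Longrightarrow> weight c_part D = weight c D"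
  by (intro weight_restrict steiner_cuts_subset)

text \<open>In case \<open>w\<close> is not a terminal of \<open>G\<close>, a terminal in
  \<open>B\<close> takes its place on the far side.\<close>

lemma steiner_cut_of_part:
  assumes D: "D \<in> steiner_cuts (part G w A)"
  shows "D \<in> steiner_cuts G"
proof -
  obtain S where S: "S \<subseteq> nodes (part G w A)" "w \<notin> S" "terminals (part G w A) \<inter> S \<noteq> {}"
      "D = cut (part G w A) S"
    by (rule steiner_cut_avoiding[OF rigid_part_steiner D])
  then have SA: "S \<subseteq> A" by auto
  have "terminals G \<inter> B \<noteq> {}" using terminal_in_side[OF steiner separates_commute[OF sep] rigid] .
  then have "terminals G - S \<noteq> {}" using SA separates_simps[OF steiner sep] by blast
  moreover have "terminals G \<inter> S \<noteq> {}" using S by auto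
  ultimately have "cut G S \<in> steiner_cuts G"
    using SA separates_simps(6)[OF steiner sep] by (intro steiner_cutI[OF steiner]) auto
  then show ?thesis using S cut_part[OF steiner sep SA] by simp
qed

text \<open>Steiner cuts of the part are Steiner cuts of \<open>G\<close>, and a tight cut through
  an edge of the side attains the bound. By symmetry both parts have the minimum of
  \<open>G\<close>.\<close>

lemma min_cut_weight_part: "min_cut_weight c_part (part G w A) = min_cut_weight c G"
proof -
  obtain e where e: "e \<in> edges G" "e \<subseteq> insert w A" "\<not> e \<subseteq> insert w B"
    by (rule edge_across_side[OF steiner sep])
  obtain D where D: "D \<in> tight_cuts c G" "e \<in> D" by (rule rigid_edge_in_tight_cut[OF rigid e(1)])
  have "D \<notin> steiner_cuts (part G w B)"
    using e D steiner_cuts_subset[of D "part G w B"] by auto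
  then have DA: "D \<in> steiner_cuts (part G w A)"
    using tight_cut_in_part[OF steiner sep _ D(1)] rigid by (auto simp: rigid_weights_def)
  have "weight c D = min_cut_weight c G" using D by (simp add: tight_cuts_def)
  then show ?thesis
    using min_cut_weight_eqI[OF rigid_part_steiner _ DA] weight_part_steiner_cut
      min_cut_weight_le[OF steiner steiner_cut_of_part] DA by metis
qed

text \<open>A test vector living on the side \<open>A\<close> vanishes trivially on tight cuts
  within \<open>B\<close>, and tight cuts within \<open>A\<close> are tight for the part. Extended
  by zero it is thus a test vector for \<open>G\<close>.\<close>

lemma rigid_weights_part: "rigid_weights c_part (part G w A)"
  unfolding rigid_weights_def
proof (intro conjI ballI impI restrict_weights_in_edge_space)
  show "c_part $ e > 0" if "e \<in> edges (part G w A)" for e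
    using that rigid by (auto simp: restrict_weights_def rigid_weights_def)
next
  fix d assume d: "d \<in> edge_space (edges (part G w A))"
    and d0: "\<forall>D\<in>tight_cuts c_part (part G w A). weight d D = 0"
  have "weight d D = 0" if D: "D \<in> tight_cuts c G" for D
  proof -
    have "D \<in> steiner_cuts (part G w A) \<or> D \<in> steiner_cuts (part G w B)"
      using tight_cut_in_part[OF steiner sep _ D] rigid by (auto simp: rigid_weights_def)
    then show ?thesis
    proof
      assume DA: "D \<in> steiner_cuts (part G w A)"
      then have "D \<in> tight_cuts c_part (part G w A)"
        using D by (simp only: tight_cuts_def min_cut_weight_part mem_Collect_eq weight_part_steiner_cut)
      then show ?thesis using d0 by blast
    next
      assume "D \<in> steiner_cuts (part G w B)"
      then have "D \<inter> edges (part G w A) = {}"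
        using steiner_cuts_subset part_edges_disjoint[OF steiner sep] by blast
      then have "\<forall>e\<in>D. d $ e = 0" using d unfolding edge_space_def by blast
      then show ?thesis by (simp add: weight_def)
    qed
  qed
  moreover have "d \<in> edge_space (edges G)" using d by (auto simp: edge_space_def)
  ultimately show "d = 0" using rigid by (auto simp: rigid_weights_def)
qed

lemma min_integer_form_part:
  assumes "min_integer_form (edges G) c"
  obtains r where "r > 0" "min_integer_form (edges (part G w A)) (r *\<^sub>R c_part)"
proof -
  obtain e where "e \<in> edges G" "e \<subseteq> insert w A" by (rule edge_across_side[OF steiner sep])
  then have e: "e \<in> edges (part G w A)" "c_part $ e \<noteq> 0"
    using rigid by (force simp: rigid_weights_def restrict_weights_def)+
  have "\<forall>e\<in>edges (part G w A). c_part $ e \<in> \<nat>"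
    using min_integer_form_Nats[OF assms] by (simp add: restrict_weights_def)
  then show thesis
    by (rule min_integer_form_exists[OF restrict_weights_in_edge_space _ e]) (rule that)
qed

end

text \<open>A separation with \<open>card A\<close> minimal works: if \<open>x\<close> separates \<open>part G w A\<close>, then the side without
  \<open>w\<close> is also a side of a separation of \<open>G\<close> at \<open>x\<close>, and it is smaller.\<close>

lemma minimal_separation:
  assumes steiner: "is_steiner_graph G" and cut: "is_cut_node G v"
  obtains w A B where "separates G w A B"
    "\<And>x A' B'. \<not> separates (part G w A) x A' B'"
proof -
  define P where "P = (\<lambda>(w, A, B). separates G w A B)"
  obtain A0 B0 where "P (v, A0, B0)" using cut_node_separates[OF assms] by (auto simp: P_def)
  then obtain t where "P t" and min: "\<And>t'. P t' \<Longrightarrow> card (fst (snd t)) \<le> card (fst (snd t'))"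
    using ex_has_least_nat[of P _ "\<lambda>t. card (fst (snd t))"] by metis
  then obtain w A B where sep: "separates G w A B"
    and min: "\<And>x A' B'. separates G x A' B' \<Longrightarrow> card A \<le> card A'"
    by (cases t) (force simp: P_def)
  note S = separates_simps[OF steiner sep]
  \<comment> \<open>The node \<open>w\<close> lies in at most one of the two sides of the part, so
    after an exchange \<open>A'\<close> may be assumed to miss it.\<close>
  have no: False if sep': "separates (part G w A) x A' B'" and w: "w \<notin> A'" for x A' B'
  proof -
    have p: "A' \<noteq> {}" "B' \<noteq> {}" "A' \<inter> B' = {}" "x \<notin> A'" "x \<notin> B'" "insert w A = insert x (A' \<union> B')"
      "\<And>e. e \<in> edges G \<Longrightarrow> e \<subseteq> insert w A \<Longrightarrow> e \<subseteq> insert x A' \<or> e \<subseteq> insert x B'"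
      using sep' by (auto simp: separates_def)
    have A': "A' \<subseteq> A"
    proof -
      have "A' \<subseteq> insert w A" unfolding p(6) by blast
      then show ?thesis using w by blast
    qed
    have x: "x \<in> nodes G" using p(6) S(6) by auto
    \<comment> \<open>\<open>C\<close> consists of \<open>B'\<close> and of what lies beyond the
      part, namely \<open>B\<close>; edges on the side of \<open>B\<close> avoid \<open>A'\<close>
      entirely.\<close>
    define C where "C = nodes G - {x} - A'"
    have B': "B' \<subseteq> C" using p S(6) by (auto simp: C_def)
    have "separates G x A' C"
      unfolding separates_def
    proof (intro conjI ballI)
      show "nodes G = insert x (A' \<union> C)" using x A' S(6) by (auto simp: C_def)
      fix e assume e: "e \<in> edges G"
      have eG: "e \<subseteq> nodes G" using edges_simple[OF steiner] e by auto
      consider "e \<subseteq> insert w A" | "e \<subseteq> insert w B" using separates_edge[OF steiner sep e] by blast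
      then show "e \<subseteq> insert x A' \<or> e \<subseteq> insert x C"
      proof cases
        case 1
        then show ?thesis using p(7)[OF e] B' by blast
      next
        case 2
        then have "e \<inter> A' = {}" using A' w S by auto
        then show ?thesis using eG by (auto simp: C_def)
      qed
    qed (use p B' in \<open>auto simp: C_def\<close>)
    then have "card A \<le> card A'" by (rule min)
    \<comment> \<open>Minimality leaves only \<open>A' = A\<close>, which forces
      \<open>x = w\<close>; but then no node remains for \<open>B'\<close>.\<close>
    then have "A' = A" using A' by (intro card_seteq) auto
    then have "x = w" using p(4,6) by blast
    have "B' \<subseteq> insert w A" unfolding p(6) by blast
    then have "B' \<subseteq> A" using p(5) \<open>x = w\<close> by blast
    then show False using p(2,3) \<open>A' = A\<close> by blast
  qed
  have "\<not> separates (part G w A) x A' B'" for x A' B'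
  proof
    assume sep': "separates (part G w A) x A' B'"
    show False
    proof (cases "w \<in> A'")
      case True
      then have "w \<notin> B'" using sep' by (auto simp: separates_def)
      then show False using no[OF separates_commute[OF sep']] by blast
    qed (use no[OF sep'] in blast)
  qed
  then show thesis using that sep by blast
qed

section \<open>Suppressing a non-terminal of degree two\<close>

lemma degree_two_neighbours:
  assumes steiner: "is_steiner_graph G" and "degree G w = 2"
  obtains u v where "{e \<in> edges G. w \<in> e} = {{u, w}, {v, w}}" "u \<noteq> v" "u \<noteq> w" "v \<noteq> w"
proof -
  obtain e1 e2 where e: "{e \<in> edges G. w \<in> e} = {e1, e2}" "e1 \<noteq> e2"
    using assms(2) by (auto simp: degree_def card_2_iff)
  have "\<exists>x. e = {x, w} \<and> x \<noteq> w" if e: "e \<in> edges G" "w \<in> e" for e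
  proof -
    obtain x y where "e = {x, y}" "x \<noteq> y" using edge_of_graph[OF steiner e(1)] by metis
    then show ?thesis using e(2) by auto
  qed
  moreover have "e1 \<in> edges G" "w \<in> e1" "e2 \<in> edges G" "w \<in> e2" using e(1) by blast+
  ultimately obtain u v where "e1 = {u, w}" "u \<noteq> w" "e2 = {v, w}" "v \<noteq> w" by metis
  then show thesis using e that[of u v] by auto
qed

context
  fixes G :: "'a::finite steiner_graph" and u v w :: 'a and c :: "'a edge_vector"
  assumes steiner: "is_steiner_graph G" and rigid: "rigid_weights c G"
    and w: "w \<in> nodes G" "w \<notin> terminals G"
    and nbrs: "{e \<in> edges G. w \<in> e} = {{u, w}, {v, w}}" and ends: "u \<noteq> v" "u \<noteq> w" "v \<noteq> w"
begin

lemma weight_cut_degree_two: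
  "weight d (cut G S) = weight d {e \<in> cut G S. w \<notin> e} +
     (if (u \<in> S) \<noteq> (w \<in> S) then d $ {u, w} else 0) + (if (v \<in> S) \<noteq> (w \<in> S) then d $ {v, w} else 0)"
proof -
  have "{u, w} \<in> edges G" "{v, w} \<in> edges G" using nbrs by blast+
  then have mem: "{u, w} \<in> cut G S \<longleftrightarrow> (u \<in> S) \<noteq> (w \<in> S)" "{v, w} \<in> cut G S \<longleftrightarrow> (v \<in> S) \<noteq> (w \<in> S)"
    using pair_in_cut ends by metis+
  have ne: "{u, w} \<noteq> {v, w}" using ends by (auto simp: doubleton_eq_iff)
  have "{e \<in> cut G S. w \<in> e} = cut G S \<inter> {{u, w}, {v, w}}"
    using nbrs cut_subset[of G S] by blast
  also have "\<dots> = (if (u \<in> S) \<noteq> (w \<in> S) then {{u, w}} else {}) \<union> (if (v \<in> S) \<noteq> (w \<in> S) then {{v, w}} else {})"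
    using mem by auto
  finally have "weight d {e \<in> cut G S. w \<in> e} =
      (if (u \<in> S) \<noteq> (w \<in> S) then d $ {u, w} else 0) + (if (v \<in> S) \<noteq> (w \<in> S) then d $ {v, w} else 0)"
    using ne by (simp add: weight_def)
  moreover have "weight d (cut G S) = weight d {e \<in> cut G S. w \<notin> e} + weight d {e \<in> cut G S. w \<in> e}"
  proof -
    have "cut G S = {e \<in> cut G S. w \<notin> e} \<union> {e \<in> cut G S. w \<in> e}" by blast
    moreover have "weight d ({e \<in> cut G S. w \<notin> e} \<union> {e \<in> cut G S. w \<in> e}) =
        weight d {e \<in> cut G S. w \<notin> e} + weight d {e \<in> cut G S. w \<in> e}"
      unfolding weight_def by (rule sum.union_disjoint) auto
    ultimately show ?thesis by simp
  qed
  ultimately show ?thesis by simp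
qed

text \<open>Moving the non-terminal \<open>w\<close> to either side keeps the cut a Steiner cut, so
  a tight cut cannot become cheaper by such a move.\<close>

lemma tight_cut_degree_twoE:
  assumes D: "D \<in> tight_cuts c G"
  obtains S where "D = cut G S" "weight c (cut G S) \<le> weight c (cut G (S - {w}))"
    "weight c (cut G S) \<le> weight c (cut G (insert w S))"
proof -
  have "D \<in> steiner_cuts G" and m: "weight c D = min_cut_weight c G" using D by (auto simp: tight_cuts_def)
  then obtain S where S: "S \<subseteq> nodes G" "terminals G \<inter> S \<noteq> {}" "terminals G - S \<noteq> {}" "D = cut G S"
    by (auto simp: steiner_cuts_def)
  have "cut G (S - {w}) \<in> steiner_cuts G" "cut G (insert w S) \<in> steiner_cuts G"
    using S w by (auto intro!: steiner_cutI[OF steiner])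
  then have "min_cut_weight c G \<le> weight c (cut G (S - {w}))"
    "min_cut_weight c G \<le> weight c (cut G (insert w S))"
    by (simp_all add: min_cut_weight_le[OF steiner])
  then show thesis using that[OF S(4)] S(4) m by simp
qed

lemma cut_away_from_node:
  "{e \<in> cut G (S - {w}). w \<notin> e} = {e \<in> cut G S. w \<notin> e}"
  "{e \<in> cut G (insert w S). w \<notin> e} = {e \<in> cut G S. w \<notin> e}"
proof -
  have "e \<in> cut G (S - {w}) \<longleftrightarrow> e \<in> cut G S" "e \<in> cut G (insert w S) \<longleftrightarrow> e \<in> cut G S"
    if "w \<notin> e" for e
  proof -
    have "e \<inter> (S - {w}) = e \<inter> S" "e \<inter> insert w S = e \<inter> S" using that by auto
    then show "e \<in> cut G (S - {w}) \<longleftrightarrow> e \<in> cut G S" "e \<in> cut G (insert w S) \<longleftrightarrow> e \<in> cut G S"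
      by (simp_all only: cut_def mem_Collect_eq)
  qed
  then show "{e \<in> cut G (S - {w}). w \<notin> e} = {e \<in> cut G S. w \<notin> e}"
    "{e \<in> cut G (insert w S). w \<notin> e} = {e \<in> cut G S. w \<notin> e}" by blast+
qed

lemma degree_two_weights_pos: "c $ {u, w} > 0" "c $ {v, w} > 0"
  using rigid nbrs unfolding rigid_weights_def by blast+

text \<open>If \<open>w\<close> were opposite to both neighbours, moving it over would save two
  positive weights. If the neighbours are separated, exactly one edge at \<open>w\<close> is cut,
  and optimality makes it a cheapest one.\<close>

lemma tight_cut_degree_two:
  assumes D: "D \<in> tight_cuts c G"
  obtains S where "D = cut G S" "\<not> ((u \<in> S) \<noteq> (w \<in> S) \<and> (v \<in> S) \<noteq> (w \<in> S))"
    "(u \<in> S) \<noteq> (v \<in> S) \<Longrightarrow> c $ {u, w} = c $ {v, w} \<or>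
       (c $ {u, w} < c $ {v, w} \<and> (u \<in> S) \<noteq> (w \<in> S)) \<or> (c $ {v, w} < c $ {u, w} \<and> (v \<in> S) \<noteq> (w \<in> S))"
proof -
  obtain S where S: "D = cut G S" "weight c (cut G S) \<le> weight c (cut G (S - {w}))"
    "weight c (cut G S) \<le> weight c (cut G (insert w S))"
    by (rule tight_cut_degree_twoE[OF D])
  show thesis
  proof (rule that[OF S(1)])
    show "\<not> ((u \<in> S) \<noteq> (w \<in> S) \<and> (v \<in> S) \<noteq> (w \<in> S))"
      using S(2,3) degree_two_weights_pos ends
      unfolding weight_cut_degree_two[of c S] weight_cut_degree_two[of c "S - {w}"]
        weight_cut_degree_two[of c "insert w S"] cut_away_from_node
      by (auto split: if_splits)
  next
    assume "(u \<in> S) \<noteq> (v \<in> S)"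
    then show "c $ {u, w} = c $ {v, w} \<or>
       (c $ {u, w} < c $ {v, w} \<and> (u \<in> S) \<noteq> (w \<in> S)) \<or> (c $ {v, w} < c $ {u, w} \<and> (v \<in> S) \<noteq> (w \<in> S))"
      using S(2,3) degree_two_weights_pos ends
      unfolding weight_cut_degree_two[of c S] weight_cut_degree_two[of c "S - {w}"]
        weight_cut_degree_two[of c "insert w S"] cut_away_from_node
      by (auto split: if_splits)
  qed
qed

text \<open>Each of the two edges lies in some tight cut, and a tight cut contains such an edge only
  if it is not dearer than the other one.\<close>

lemma degree_two_weights_eq: "c $ {u, w} = c $ {v, w}"
proof -
  have E: "{u, w} \<in> edges G" "{v, w} \<in> edges G" using nbrs by blast+
  obtain D where D: "D \<in> tight_cuts c G" "{u, w} \<in> D" by (rule rigid_edge_in_tight_cut[OF rigid E(1)])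
  obtain D' where D': "D' \<in> tight_cuts c G" "{v, w} \<in> D'" by (rule rigid_edge_in_tight_cut[OF rigid E(2)])
  have "c $ {u, w} \<le> c $ {v, w}"
    using tight_cut_degree_two[OF D(1)] D(2) pair_in_cut[OF ends(2)] by (metis less_eq_real_def)
  moreover have "c $ {v, w} \<le> c $ {u, w}"
    using tight_cut_degree_two[OF D'(1)] D'(2) pair_in_cut[OF ends(3)] by (metis less_eq_real_def)
  ultimately show ?thesis by simp
qed

text \<open>Suppressing \<open>w\<close> joins its neighbours by an edge, which would be parallel to
  an existing one if the triangle were present.\<close>

lemma degree_two_no_triangle: "{u, v} \<notin> edges G"
proof
  assume uv: "{u, v} \<in> edges G"
  have E: "{u, w} \<in> edges G" "{v, w} \<in> edges G" using nbrs by blast+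
  \<comment> \<open>No tight cut contains both edges at \<open>w\<close>, so on tight cuts the edge \<open>{u, v}\<close> is cut iff one of them is.\<close>
  define d :: "'a edge_vector" where "d = axis {u, w} 1 + axis {v, w} 1 - axis {u, v} 1"
  have "d \<in> edge_space (edges G)"
    using E uv unfolding d_def
    by (intro subspace_add subspace_diff edge_space_subspace axis_in_edge_space)
  moreover have "weight d D = 0" if D: "D \<in> tight_cuts c G" for D
  proof -
    obtain S where S: "D = cut G S" "\<not> ((u \<in> S) \<noteq> (w \<in> S) \<and> (v \<in> S) \<noteq> (w \<in> S))"
      using tight_cut_degree_two[OF D] by metis
    then show ?thesis
      using pair_in_cut[OF ends(1), of G S] pair_in_cut[OF ends(2), of G S] pair_in_cut[OF ends(3), of G S] E uv
      unfolding d_def weight_minus weight_add weight_axis S(1) by auto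
  qed
  ultimately have "d = 0" using rigid by (auto simp: rigid_weights_def)
  then have "d $ {u, v} = 0" by simp
  then show False using ends by (simp add: d_def axis_def doubleton_eq_iff)
qed

definition suppressed :: "'a steiner_graph" where
  "suppressed = \<lparr>nodes = nodes G - {w}, edges = insert {u, v} {e \<in> edges G. w \<notin> e},
     terminals = terminals G\<rparr>"

lemma suppressed_steiner: "is_steiner_graph suppressed"
proof -
  have E: "{u, w} \<in> edges G" "{v, w} \<in> edges G" using nbrs by blast+
  have uv: "u \<in> nodes G - {w}" "v \<in> nodes G - {w}"
    using edges_simple[OF steiner] E ends by (auto simp: doubleton_eq_iff)
  have simple: "edges suppressed \<subseteq> simple_edges (nodes suppressed)"
  proof
    fix e assume e: "e \<in> edges suppressed"
    show "e \<in> simple_edges (nodes suppressed)"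
    proof (cases "e = {u, v}")
      case True
      then show ?thesis using uv ends by (auto simp: suppressed_def)
    next
      case False
      then have "e \<in> edges G" "w \<notin> e" using e by (auto simp: suppressed_def)
      then obtain x y where "e = {x, y}" "x \<in> nodes G" "y \<in> nodes G" "x \<noteq> y" "w \<notin> e"
        using edge_of_graph[OF steiner] by metis
      then show ?thesis by (auto simp: suppressed_def)
    qed
  qed
  have "\<exists>e\<in>edges suppressed. e \<inter> S \<noteq> {} \<and> e - S \<noteq> {}"
    if S: "S \<subseteq> nodes G - {w}" "S \<noteq> {}" "S \<noteq> nodes G - {w}" for S
  proof (cases "(u \<in> S) = (v \<in> S)")
    case True
    \<comment> \<open>\<open>w\<close> joins the common side of its neighbours, so the crossing edge
      is not incident with \<open>w\<close> and survives the suppression.\<close>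
    define R where "R = (if u \<in> S then insert w S else S)"
    have "cut G R \<noteq> {}" using S w by (intro cut_nonempty[OF steiner]) (auto simp: R_def)
    then obtain e where "e \<in> cut G R" by blast
    then have e: "e \<in> edges G" "e \<inter> R \<noteq> {}" "e - R \<noteq> {}"
      by (auto simp: in_cut_iff[OF edges_simple[OF steiner]])
    have "e \<noteq> {u, w}" "e \<noteq> {v, w}" using e True S ends by (auto simp: R_def split: if_splits)
    then have "w \<notin> e" using nbrs e(1) by blast
    then have "e \<inter> S \<noteq> {}" "e - S \<noteq> {}" using e by (auto simp: R_def split: if_splits)
    then show ?thesis using e(1) \<open>w \<notin> e\<close> by (auto simp: suppressed_def)
  qed (auto simp: suppressed_def)
  then have "connected_graph (nodes suppressed) (edges suppressed)"
    unfolding connected_graph_iff_cuts[OF simple] using uv by (auto simp: suppressed_def)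
  then show ?thesis
    using simple terminals_subset[OF steiner] terminals_card[OF steiner] w(2)
    unfolding is_steiner_graph_def by (auto simp: suppressed_def)
qed

lemma suppressed_subdivides: "subdivides_edge suppressed u v w G"
proof -
  have "edges G = {e \<in> edges G. w \<notin> e} \<union> {{u, w}, {v, w}}" using nbrs by blast
  moreover have "edges suppressed - {{u, v}} = {e \<in> edges G. w \<notin> e}"
    using degree_two_no_triangle by (auto simp: suppressed_def)
  ultimately show ?thesis using w unfolding subdivides_edge_def by (auto simp: suppressed_def)
qed

lemma suppressed_weights:
  obtains c' where "c = subdivided_weights (edges suppressed) u v w c'"
    "c' \<in> edge_space (edges suppressed)" "\<forall>e\<in>edges suppressed. c' $ e > 0"
proof
  \<comment> \<open>The new edge takes the weight shared by the two edges at \<open>w\<close>. Those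
    are zeroed so that the vector lies in the edge space of the smaller graph.\<close>
  define c' where "c' = (\<chi> e. if e = {u, v} then c $ {u, w} else if w \<in> e then 0 else c $ e)"
  have off: "c $ e = 0" if "e \<notin> edges G" for e
    using that rigid by (auto simp: rigid_weights_def edge_space_def)
  have pos: "c $ e > 0" if "e \<in> edges G" for e
    using that rigid by (auto simp: rigid_weights_def)
  show "c = subdivided_weights (edges suppressed) u v w c'"
    unfolding vec_eq_iff
  proof
    fix e
    consider "e = {u, w} \<or> e = {v, w}" | "e \<in> edges G" "w \<notin> e" | "e \<notin> edges G" "e \<noteq> {u, w}" "e \<noteq> {v, w}"
      using nbrs by blast
    then show "c $ e = subdivided_weights (edges suppressed) u v w c' $ e"
    proof cases
      case 1
      then show ?thesis using degree_two_weights_eq by (auto simp: subdivided_weights_def c'_def)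
    next
      case 2
      then have "e \<noteq> {u, v}" "e \<noteq> {u, w}" "e \<noteq> {v, w}" using degree_two_no_triangle by auto
      then show ?thesis using 2 by (simp add: subdivided_weights_def c'_def suppressed_def)
    next
      case 3
      then show ?thesis using off by (simp add: subdivided_weights_def suppressed_def)
    qed
  qed
  show "c' \<in> edge_space (edges suppressed)"
    using off by (auto simp: edge_space_def c'_def suppressed_def)
  show "\<forall>e\<in>edges suppressed. c' $ e > 0"
    using pos degree_two_weights_pos by (auto simp: c'_def suppressed_def)
qed

end

lemma suppress_degree_two:
  assumes steiner: "is_steiner_graph G" and rigid: "rigid_weights c G"
    and integer: "min_integer_form (edges G) c"
    and w: "w \<in> nodes G - terminals G" "degree G w = 2"
  obtains G' c' where "is_steiner_graph G'" "card (nodes G') < card (nodes G)"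
    "subdivision_weighted (G', c') (G, c)" "rigid_weights c' G'" "min_integer_form (edges G') c'"
proof -
  obtain u v where uv: "{e \<in> edges G. w \<in> e} = {{u, w}, {v, w}}" "u \<noteq> v" "u \<noteq> w" "v \<noteq> w"
    by (rule degree_two_neighbours[OF steiner w(2)])
  have w': "w \<in> nodes G" "w \<notin> terminals G" using w by auto
  note ctxt = steiner rigid w' uv
  let ?G' = "suppressed G u v w"
  have st: "is_steiner_graph ?G'" and sub: "subdivides_edge ?G' u v w G"
    using suppressed_steiner[OF ctxt] suppressed_subdivides[OF ctxt] by auto
  obtain c' where c': "c = subdivided_weights (edges ?G') u v w c'"
    "c' \<in> edge_space (edges ?G')" "\<forall>e\<in>edges ?G'. c' $ e > 0"
    by (rule suppressed_weights[OF ctxt])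
  have "rigid_weights c' ?G'"
    using rigid_weights_subdivisionD[OF st sub c'(3)] rigid c' by blast
  moreover have "min_integer_form (edges ?G') c'"
    using subdivided_weights_values[OF st sub, of c'] c'
    by (intro min_integer_form_same_values[OF integer c'(2)]) auto
  moreover have "subdivision_weighted (?G', c') (G, c)"
    unfolding subdivision_weighted_iff[OF st] using sub c'(1) by blast
  moreover have "card (nodes ?G') < card (nodes G)"
    using w' card_Diff1_less[of "nodes G" w] by (simp only: suppressed_def[OF ctxt] steiner_graph.simps finite)
  ultimately show thesis using that st by blast
qed

section \<open>Constructability\<close>

lemma subdivision_weighted_provides:
  assumes "is_steiner_graph G'" "provides_facet_weights c' G'" "subdivision_weighted (G', c') (G, c)"
  shows "is_steiner_graph G \<and> provides_facet_weights c G"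
proof -
  obtain u v w where sub: "subdivides_edge G' u v w G" and c: "c = subdivided_weights (edges G') u v w c'"
    using assms(1,3) by (auto simp: subdivision_weighted_iff)
  have "min_integer_form (edges G') c'" and rigid: "rigid_weights c' G'"
    using assms(1,2) by (auto simp: provides_facet_weights_iff_rigid)
  have steiner: "is_steiner_graph G" by (rule subdivision_steiner[OF assms(1) sub])
  have "\<forall>e\<in>edges G'. c' $ e > 0" using rigid by (simp add: rigid_weights_def)
  then have rigid: "rigid_weights c G" unfolding c
    by (rule rigid_weights_subdivision[OF assms(1) sub _ rigid])
  then have "c \<in> edge_space (edges G)" by (simp add: rigid_weights_def)
  then have "min_integer_form (edges G) c"
    using min_integer_form_same_values \<open>min_integer_form (edges G') c'\<close>
      subdivided_weights_values[OF assms(1) sub] c by metis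
  then show ?thesis using steiner rigid by (simp add: provides_facet_weights_iff_rigid)
qed

lemma gluing_weighted_provides:
  assumes "is_steiner_graph G1" "provides_facet_weights c1 G1"
    and "is_steiner_graph G2" "provides_facet_weights c2 G2"
    and "gluing_weighted (G1, c1) (G2, c2) (G, c)"
  shows "is_steiner_graph G \<and> provides_facet_weights c G"
proof -
  obtain w where glued: "glued_at w G1 G2 G"
    using assms(5) by (auto simp: gluing_weighted_def gluing_iff_glued_at)
  obtain r where r: "r > 0" "min_integer_form (edges G) c"
    "c = r *\<^sub>R (min_cut_weight c2 G2 *\<^sub>R c1 + min_cut_weight c1 G1 *\<^sub>R c2)"
    using assms(5) by (auto simp: gluing_weighted_def min_integer_form_of_def)
  have rigid: "rigid_weights c1 G1" "rigid_weights c2 G2"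
    using assms by (auto simp: provides_facet_weights_iff_rigid)
  have steiner: "is_steiner_graph G" by (rule glued_steiner[OF assms(1,3) glued])
  have "rigid_weights c G" unfolding r(3)
    by (intro rigid_weights_scaleR steiner r(1) rigid_weights_glued[OF assms(1,3) glued rigid])
  then show ?thesis using steiner r(2) by (simp add: provides_facet_weights_iff_rigid)
qed

text \<open>An unweighted gluing can be equipped with any facet weights of its pieces: the combined
  vector has a minimum integer form because its entries are natural numbers, not all zero.\<close>

lemma gluing_provides_some:
  fixes G1 G2 G :: "'a::finite steiner_graph"
  assumes "is_steiner_graph G1" "provides_facet_weights c1 G1"
    and "is_steiner_graph G2" "provides_facet_weights c2 G2" and "gluing G1 G2 G"
  obtains c where "gluing_weighted (G1, c1) (G2, c2) (G, c)"
proof -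
  obtain w where glued: "glued_at w G1 G2 G" using assms(5) by (auto simp: gluing_iff_glued_at)
  let ?x = "min_cut_weight c2 G2 *\<^sub>R c1 + min_cut_weight c1 G1 *\<^sub>R c2"
  have rigid: "rigid_weights c1 G1" "rigid_weights c2 G2"
    and int: "min_integer_form (edges G1) c1" "min_integer_form (edges G2) c2"
    using assms by (auto simp: provides_facet_weights_iff_rigid)
  have rx: "rigid_weights ?x G" by (rule rigid_weights_glued[OF assms(1,3) glued rigid])
  \<comment> \<open>The minimum is attained by a cut, hence is a sum of natural weights.\<close>
  have mn: "min_cut_weight c H \<in> \<nat>" if H: "is_steiner_graph H" "min_integer_form (edges H) c"
    for c :: "'a edge_vector" and H :: "'a steiner_graph"
  proof -
    obtain D where D: "D \<in> steiner_cuts H" "weight c D = min_cut_weight c H"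
      by (rule min_cut_weight_attained[OF H(1)])
    obtain k where "\<forall>e\<in>edges H. c $ e = real (k e)" using H(2) by (auto simp: min_integer_form_def)
    then have "weight c D = real (sum k D)" unfolding weight_def of_nat_sum
      using steiner_cuts_subset[OF D(1)] by (intro sum.cong) auto
    then show ?thesis using D by (metis of_nat_in_Nats)
  qed
  have N: "c $ e \<in> \<nat>" if "min_integer_form E c" for c :: "'a edge_vector" and e E
    using that by (cases "e \<in> E") (auto simp: min_integer_form_def edge_space_def)
  have "\<forall>e\<in>edges G. ?x $ e \<in> \<nat>"
    using N[OF int(1)] N[OF int(2)] mn[OF assms(1) int(1)] mn[OF assms(3) int(2)]
    by (simp add: Nats_add Nats_mult)
  moreover obtain e where e: "e \<in> edges G"
    using steiner_cuts_nonempty[OF glued_steiner[OF assms(1,3) glued]]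
      steiner_cut_nonempty[OF glued_steiner[OF assms(1,3) glued]] steiner_cuts_subset by blast
  moreover have "?x $ e \<noteq> 0" "?x \<in> edge_space (edges G)"
    using rx e unfolding rigid_weights_def by (blast dest: less_imp_neq[symmetric] | force)+
  ultimately obtain r where r: "r > 0" "min_integer_form (edges G) (r *\<^sub>R ?x)"
    using min_integer_form_exists by metis
  then have "gluing_weighted (G1, c1) (G2, c2) (G, r *\<^sub>R ?x)"
    using assms(5) by (auto simp: gluing_weighted_def min_integer_form_of_def)
  then show thesis by (rule that)
qed

lemma subdivision_provides_some:
  assumes "is_steiner_graph G'" "subdivision G' G"
  obtains c where "subdivision_weighted (G', c') (G, c)"
  using assms(2) that unfolding subdivision_def subdivision_weighted_iff[OF assms(1)] by blast

text \<open>The weights are only claimed to exist, so at each step they can be chosen for the pieces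
  at hand. The terminal bound persists because neither operand of a gluing has more terminals than
  the result, and subdivision keeps the terminals.\<close>

lemma constructed_provides:
  assumes "constructed_from subdivision gluing irreducible_facet_inducing Hs G"
  shows "is_steiner_graph G \<and> (\<exists>c. provides_facet_weights c G) \<and>
    (\<forall>H\<in>set Hs. card (terminals H) \<le> card (terminals G))"
  using assms
proof induction
  case (start H)
  then show ?case by (auto simp: irreducible_facet_inducing_def facet_inducing_def)
next
  case (subdivide Hs G' G)
  then obtain c' where "is_steiner_graph G'" "provides_facet_weights c' G'" by blast
  moreover from this obtain c where "subdivision_weighted (G', c') (G, c)"
    using subdivision_provides_some subdivide by metis
  moreover have "terminals G = terminals G'"
    using subdivide by (auto simp: subdivision_def subdivides_edge_def)
  ultimately show ?case using subdivision_weighted_provides subdivide by metis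
next
  case (glue Hs G' H G)
  then obtain c' d where G': "is_steiner_graph G'" "provides_facet_weights c' G'"
    and H: "is_steiner_graph H" "provides_facet_weights d H"
    by (auto simp: irreducible_facet_inducing_def facet_inducing_def)
  obtain c where "gluing_weighted (G', c') (H, d) (G, c)"
    using gluing_provides_some[OF G' H] glue by metis
  then have G: "is_steiner_graph G \<and> provides_facet_weights c G"
    by (rule gluing_weighted_provides[OF G' H])
  obtain w where "glued_at w G' H G" using glue by (auto simp: gluing_iff_glued_at)
  then have "card (terminals G') \<le> card (terminals G)" "card (terminals H) \<le> card (terminals G)"
    using glued_terminals_card G'(1) H(1) glued_at_commute by metis+
  then show ?case using G glue.IH by (auto intro: order_trans)
qed

text \<open>The last conjunct forgets the weights of a construction. It transfers the terminal bound
  and gives one direction of the unweighted equivalence.\<close>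

lemma constructed_weighted_provides:
  assumes "constructed_from subdivision_weighted gluing_weighted
    irreducible_facet_inducing_weighted Ws W"
  shows "is_steiner_graph (fst W) \<and> provides_facet_weights (snd W) (fst W) \<and>
    constructed_from subdivision gluing irreducible_facet_inducing (map fst Ws) (fst W)"
  using assms
proof induction
  case (start W)
  then show ?case
    by (auto simp: irreducible_facet_inducing_weighted_def irreducible_facet_inducing_def
        facet_inducing_weighted_def facet_inducing_def intro!: constructed_from.start)
next
  case (subdivide Ws W' W)
  obtain G' c' G c where W: "W' = (G', c')" "W = (G, c)" by (metis surj_pair)
  have "subdivision G' G" using subdivide W by (auto simp: subdivision_weighted_def subdivision_def)
  then show ?case
    using subdivision_weighted_provides subdivide constructed_from.subdivide[of subdivision]
    unfolding W fst_conv snd_conv by metis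
next
  case (glue Ws W' X W)
  obtain G' c' H d G c where W: "W' = (G', c')" "X = (H, d)" "W = (G, c)" by (metis surj_pair)
  have H: "is_steiner_graph H" "provides_facet_weights d H" "H \<in> irreducible_facet_inducing"
    using glue(2) by (auto simp: W irreducible_facet_inducing_weighted_def irreducible_facet_inducing_def
        facet_inducing_weighted_def facet_inducing_def)
  have "gluing G' H G" using glue W by (auto simp: gluing_weighted_def)
  then have "constructed_from subdivision gluing irreducible_facet_inducing (map fst Ws @ [H]) G"
    using glue H unfolding W fst_conv by (intro constructed_from.glue) auto
  moreover have "is_steiner_graph G \<and> provides_facet_weights c G"
    using glue gluing_weighted_provides[OF _ _ H(1,2)] unfolding W fst_conv snd_conv by blast
  ultimately show ?case by (simp add: W)
qed

text \<open>The side without cut nodes is glued on last as an irreducible member; the rest has fewer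
  nodes and is left to the induction. The degree assumption on \<open>G\<close> is what makes this
  side irreducible.\<close>

lemma constructable_weighted_cut_node:
  assumes steiner: "is_steiner_graph G" and integer: "min_integer_form (edges G) c"
    and rigid: "rigid_weights c G"
    and cut: "is_cut_node G v" and deg: "\<forall>z\<in>nodes G - terminals G. degree G z \<noteq> 2"
  obtains G1 c1 W where "is_steiner_graph G1" "min_integer_form (edges G1) c1" "rigid_weights c1 G1"
    "card (nodes G1) < card (nodes G)" "W \<in> irreducible_facet_inducing_weighted"
    "gluing_weighted (G1, c1) W (G, c)"
proof -
  obtain w A B where sep: "separates G w A B"
    and leaf: "\<And>x A' B'. \<not> separates (part G w A) x A' B'"
    using minimal_separation[OF steiner cut] by metis
  note sep' = separates_commute[OF sep]
  note S = separates_simps[OF steiner sep]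
  let ?GA = "part G w A" and ?GB = "part G w B"
  let ?cA = "restrict_weights (edges ?GA) c" and ?cB = "restrict_weights (edges ?GB) c"
  have stA: "is_steiner_graph ?GA" and stB: "is_steiner_graph ?GB"
    using rigid_part_steiner[OF steiner sep rigid] rigid_part_steiner[OF steiner sep' rigid] by auto
  obtain a where a: "a > 0" "min_integer_form (edges ?GA) (a *\<^sub>R ?cA)"
    by (rule min_integer_form_part[OF steiner sep rigid integer])
  obtain b where b: "b > 0" "min_integer_form (edges ?GB) (b *\<^sub>R ?cB)"
    by (rule min_integer_form_part[OF steiner sep' rigid integer])
  have rA: "rigid_weights (a *\<^sub>R ?cA) ?GA" and rB: "rigid_weights (b *\<^sub>R ?cB) ?GB"
    using rigid_weights_scaleR[OF stA a(1) rigid_weights_part[OF steiner sep rigid]]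
      rigid_weights_scaleR[OF stB b(1) rigid_weights_part[OF steiner sep' rigid]] by auto
  have "\<not> is_cut_node ?GA x" for x using cut_node_separates[OF stA] leaf by metis
  \<comment> \<open>All edges at a node of \<open>A\<close> lie in the part, so its degree is
    unchanged; \<open>w\<close>, whose degree may drop to two, is a terminal of the part.\<close>
  moreover have "degree ?GA z \<noteq> 2" if z: "z \<in> nodes ?GA - terminals ?GA" for z
  proof -
    have zA: "z \<in> A" "z \<in> nodes G - terminals G" using z S(6) by auto
    then have "{e \<in> edges ?GA. z \<in> e} = {e \<in> edges G. z \<in> e}"
      using edge_meeting_side[OF steiner sep] by auto
    then show ?thesis using deg zA by (simp add: degree_def)
  qed
  ultimately have F: "(?GA, a *\<^sub>R ?cA) \<in> irreducible_facet_inducing_weighted"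
    using stA rA a(2) by (auto simp: irreducible_facet_inducing_weighted_def irreducible_graph_def
      facet_inducing_weighted_def provides_facet_weights_iff_rigid simp del: part_simps)
  let ?g = "min_cut_weight c G"
  have mA: "min_cut_weight (a *\<^sub>R ?cA) ?GA = a * ?g"
    using a(1) min_cut_weight_part[OF steiner sep rigid] by (simp add: min_cut_weight_scaleR[OF stA] del: part_simps)
  have mB: "min_cut_weight (b *\<^sub>R ?cB) ?GB = b * ?g"
    using b(1) min_cut_weight_part[OF steiner sep' rigid] by (simp add: min_cut_weight_scaleR[OF stB] del: part_simps)
  have sum: "?cA + ?cB = c"
    unfolding vec_eq_iff
  proof
    fix e
    have "\<not> (e \<in> edges ?GA \<and> e \<in> edges ?GB)" using part_edges_disjoint[OF steiner sep] by blast
    moreover have "e \<in> edges ?GA \<or> e \<in> edges ?GB \<or> c $ e = 0"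
      using separates_edge[OF steiner sep, of e] rigid by (auto simp: rigid_weights_def edge_space_def)
    ultimately show "(?cA + ?cB) $ e = c $ e" by (auto simp: restrict_weights_def simp del: part_simps)
  qed
  have g: "?g > 0" using rigid min_cut_weight_pos[OF steiner] by (auto simp: rigid_weights_def)
  \<comment> \<open>The minima of the rescaled parts are \<open>a * ?g\<close> and
    \<open>b * ?g\<close>, so crosswise multiplication gives both parts the same factor
    \<open>a * b * ?g\<close>, and the sum is a multiple of \<open>c\<close>.\<close>
  have eq: "(a * ?g) *\<^sub>R b *\<^sub>R ?cB + (b * ?g) *\<^sub>R a *\<^sub>R ?cA = (a * b * ?g) *\<^sub>R (?cA + ?cB)"
    by (simp add: algebra_simps del: part_simps)
  have "c = (1 / (a * b * ?g)) *\<^sub>R ((a * ?g) *\<^sub>R b *\<^sub>R ?cB + (b * ?g) *\<^sub>R a *\<^sub>R ?cA)"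
    unfolding eq sum using a(1) b(1) g by simp
  moreover have "1 / (a * b * ?g) > 0" using a(1) b(1) g by simp
  ultimately have "min_integer_form_of (edges G) ((a * ?g) *\<^sub>R b *\<^sub>R ?cB + (b * ?g) *\<^sub>R a *\<^sub>R ?cA) c"
    unfolding min_integer_form_of_def using integer by blast
  moreover have "gluing ?GB ?GA G"
    unfolding gluing_iff_glued_at using glued_at_parts[OF steiner sep'] by blast
  ultimately have "gluing_weighted (?GB, b *\<^sub>R ?cB) (?GA, a *\<^sub>R ?cA) (G, c)"
    unfolding gluing_weighted_def prod.case mA mB by blast
  moreover have "card (nodes ?GB) < card (nodes G)"
    using S by (intro psubset_card_mono) auto
  ultimately show thesis using that stB b(2) rB F by blast
qed

lemma rigid_constructable:
  assumes "is_steiner_graph G" "min_integer_form (edges G) c" "rigid_weights c G"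
  shows "constructable_weighted irreducible_facet_inducing_weighted (G, c)"
  using assms
proof (induction "card (nodes G)" arbitrary: G c rule: less_induct)
  case less
  show ?case
  proof (cases "\<exists>w\<in>nodes G - terminals G. degree G w = 2")
    case True
    then obtain w where "w \<in> nodes G - terminals G" "degree G w = 2" by blast
    then obtain G' c' where G': "is_steiner_graph G'" "card (nodes G') < card (nodes G)"
      "subdivision_weighted (G', c') (G, c)" "rigid_weights c' G'" "min_integer_form (edges G') c'"
      by (rule suppress_degree_two[OF less.prems(1,3,2)])
    then have "constructable_weighted irreducible_facet_inducing_weighted (G', c')"
      using less.hyps by blast
    then show ?thesis
      using G'(3) unfolding constructable_weighted_def by (auto intro: constructed_from.subdivide)
  next
    case no_degree_two: False
    show ?thesis
    proof (cases "\<exists>v. is_cut_node G v")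
      case True
      then obtain v where v: "is_cut_node G v" by blast
      have deg: "\<forall>z\<in>nodes G - terminals G. degree G z \<noteq> 2" using no_degree_two by blast
      obtain G1 c1 W where G1: "is_steiner_graph G1" "min_integer_form (edges G1) c1"
        "rigid_weights c1 G1" "card (nodes G1) < card (nodes G)"
        and W: "W \<in> irreducible_facet_inducing_weighted" "gluing_weighted (G1, c1) W (G, c)"
        by (rule constructable_weighted_cut_node[OF less.prems v deg])
      from G1 have "constructable_weighted irreducible_facet_inducing_weighted (G1, c1)"
        using less.hyps by blast
      then show ?thesis
        using W unfolding constructable_weighted_def by (auto intro: constructed_from.glue)
    next
      case False
      then have "irreducible_graph G" using no_degree_two by (simp add: irreducible_graph_def)
      then have "(G, c) \<in> irreducible_facet_inducing_weighted"
        using less.prems by (simp add: irreducible_facet_inducing_weighted_def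
          facet_inducing_weighted_def provides_facet_weights_iff_rigid)
      then show ?thesis unfolding constructable_weighted_def by (blast intro: constructed_from.start)
    qed
  qed
qed

theorem mainTheorem2:
  fixes G :: "'a::finite steiner_graph"
  assumes "is_steiner_graph G"
  shows
    "((facet_inducing G \<longleftrightarrow> constructable irreducible_facet_inducing G) \<and>
      (\<forall>Hs. constructed_from subdivision gluing irreducible_facet_inducing Hs G \<longrightarrow>
         (\<forall>H \<in> set Hs. card (terminals H) \<le> card (terminals G)))) \<and>
     (\<forall>c \<in> edge_space (edges G).
        (facet_inducing_weighted (G, c) \<longleftrightarrow>
           constructable_weighted irreducible_facet_inducing_weighted (G, c)) \<and>
        (\<forall>Hs. constructed_from subdivision_weighted gluing_weighted
                irreducible_facet_inducing_weighted Hs (G, c) \<longrightarrow>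
           (\<forall>(H, d) \<in> set Hs. card (terminals H) \<le> card (terminals G))))"
proof -
  have weighted: "provides_facet_weights c G \<longleftrightarrow>
      constructable_weighted irreducible_facet_inducing_weighted (G, c)" for c
  proof
    assume "provides_facet_weights c G"
    then show "constructable_weighted irreducible_facet_inducing_weighted (G, c)"
      using rigid_constructable assms provides_facet_weights_iff_rigid by blast
  next
    assume "constructable_weighted irreducible_facet_inducing_weighted (G, c)"
    then obtain Ws where "constructed_from subdivision_weighted gluing_weighted
        irreducible_facet_inducing_weighted Ws (G, c)" unfolding constructable_weighted_def by blast
    from constructed_weighted_provides[OF this] show "provides_facet_weights c G" by simp
  qed
  \<comment> \<open>From left to right, the weights of a weighted construction are forgotten; from
    right to left, suitable weights arise along the unweighted construction.\<close>
  have "facet_inducing G \<longleftrightarrow> constructable irreducible_facet_inducing G"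
  proof
    assume "facet_inducing G"
    then obtain c where "constructable_weighted irreducible_facet_inducing_weighted (G, c)"
      using weighted by (auto simp: facet_inducing_def)
    then obtain Ws where "constructed_from subdivision_weighted gluing_weighted
        irreducible_facet_inducing_weighted Ws (G, c)" unfolding constructable_weighted_def by blast
    from constructed_weighted_provides[OF this] show "constructable irreducible_facet_inducing G"
      by (auto simp: constructable_def)
  next
    assume "constructable irreducible_facet_inducing G"
    then show "facet_inducing G"
      using constructed_provides by (auto simp: constructable_def facet_inducing_def)
  qed
  moreover have "card (terminals H) \<le> card (terminals G)"
    if "constructed_from subdivision gluing irreducible_facet_inducing Hs G" "H \<in> set Hs" for Hs H
    using constructed_provides that by blast
  moreover have "card (terminals H) \<le> card (terminals G)"
    if "constructed_from subdivision_weighted gluing_weighted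
      irreducible_facet_inducing_weighted Ws (G, c)" "(H, d) \<in> set Ws" for Ws c H d
  proof -
    have "constructed_from subdivision gluing irreducible_facet_inducing (map fst Ws) G"
      using constructed_weighted_provides[OF that(1)] by simp
    moreover have "H \<in> set (map fst Ws)" using that(2) by force
    ultimately show ?thesis using constructed_provides by blast
  qed
  ultimately show ?thesis using weighted unfolding facet_inducing_weighted_def by auto
qed

end
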